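(* Let $X(t)$, $t\in(0,1)$, be a centered locally stationary Gaussian process with a.s. continuous sample paths, unit variance and correlation function $r(\cdot,\cdot)$ satisfying $$\lim_{h\to 0}\frac{1-r(t,t+h)}{K^2(|h|)}=C(t)$$ uniformly in $t\in I$ for every compact interval $I\subset(0,1)$, and with $r(s,t)<1$ for all $s\neq t\in(0,1)$. Let $S\in\{0,1\}$ and suppose that $|f(S)|=\infty$, where $f(t)=\int_{1/2}^t (C(s))^{1/\alpha}\,ds$, and that Conditions A($S$), B($S$) and C($S$) (given in the context) are satisfied. Let $E(0)=(0,1/2]$, $E(1)=[1/2,1)$, and for $c>0$ put $$J_{c,w}(S)=\left|\int_{1/2}^S (C(t))^{1/\alpha}e^{-c\,w^2(t)}\,dt\right|.$$ Then $$\sup_{t\in E(S)}\frac{\chi_{\boldsymbol b}^2(t)}{w^2(t)}<\infty\ \text{ a.s.}\quad\Longleftrightarrow\quad J_{c,w}(S)<\infty\ \text{ for some } c>0 .$$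
   Context: Chi-square process: $n\ge 1$, $1\le k\le n$, and constants $1=b_1=\dots=b_k>b_{k+1}\ge\dots\ge b_n>0$ are given; $\chi^2_{\boldsymbol b}(t)=\sum_{i=1}^n b_i^2X_i^2(t)$, where $X_1,\dots,X_n$ are independent copies of $X$ (the generic process). Local stationarity: $K(\cdot)$ is a positive function regularly varying at $0$ with index $\alpha/2\in(0,1]$; $C(\cdot)$ is a positive continuous function on $(0,1)$ with $\lim_{t\to0}C(t)=\infty$ or $\lim_{t\to1}C(t)=\infty$. The inverse $q(u)=\overleftarrow{K}(u^{-1/2})$ of $K$ at the point $u^{-1/2}$ is assumed to exist asymptotically (for large $u$). The weight $w$ is a positive continuous function on $(0,1)$. Partition: with $f(t)=\int_{1/2}^t(C(s))^{1/\alpha}ds$, $t\in(0,1)$ ($f(0),f(1)$ being the limits at the endpoints), let $\overleftarrow{f}$ be the inverse function of $f$ on $(f(0),f(1))$. For $d>0$: if $f(1)=\infty$, put $s^{(1)}_{j,d}=\overleftarrow{f}(jd)$, $j\ge0$, and $\Delta^{(1)}_{j,d}=[s^{(1)}_{j-1,d},s^{(1)}_{j,d}]$, $j\ge1$; if $f(0)=-\infty$, put $s^{(0)}_{j,d}=\overleftarrow{f}(-jd)$, $j\ge0$, and $\Delta^{(0)}_{j,d}=[s^{(0)}_{j,d},s^{(0)}_{j-1,d}]$, $j\ge1$. Condition A($S$): $w^2$ is monotone in a neighbourhood of $S$ and $\lim_{t\to S}w^2(t)=\infty$. Condition B($S$): there exists a constant $d_0>0$ such that $$\limsup_{j\to\infty}\sup_{t\ne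 s\in\Delta^{(S)}_{j,d_0}}\frac{1-r(t,s)}{K^2(|f(t)-f(s)|)}<\infty,$$ and, when $\alpha=2$ and $k=1$, in addition $K^2(|t|)=O(t^2)$ as $t\to0$. Condition C($S$): there exists a constant $d_0>0$ such that $$\liminf_{j\to\infty}\inf_{t\ne s\in\Delta^{(S)}_{j,d_0}}\frac{1-r(t,s)}{K^2(|f(t)-f(s)|)}>0,$$ and moreover there exist $j_0,l_0\in\mathbb N$ and $M_0,\beta>0$ such that for all $j\ge j_0$, $l\ge l_0$, $$\sup_{s\in\Delta^{(S)}_{j+l,d_0},\,t\in\Delta^{(S)}_{j,d_0}}|r(s,t)|<M_0\,l^{-\beta}.$$ *)

theory Defs
  imports "HOL-Probability.Probability" "HOL-Library.Landau_Symbols"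
begin

section \<open>Gaussian processes and independent copies\<close>

definition correlation :: "'a measure \<Rightarrow> ('a \<Rightarrow> real) \<Rightarrow> ('a \<Rightarrow> real) \<Rightarrow> real" where
  "correlation M U V =
     prob_space.expectation M (\<lambda>\<omega>. (U \<omega> - prob_space.expectation M U) * (V \<omega> - prob_space.expectation M V))
     / sqrt (prob_space.variance M U * prob_space.variance M V)"

text \<open>Degenerate (almost surely constant) variables count as Gaussian.\<close>

definition gaussian_rv :: "'a measure \<Rightarrow> ('a \<Rightarrow> real) \<Rightarrow> bool" where
  "gaussian_rv M Y \<longleftrightarrow> Y \<in> borel_measurable M \<and>
     ((\<exists>m. AE \<omega> in M. Y \<omega> = m) \<or>
      (\<exists>m \<sigma>. 0 < \<sigma> \<and> distributed M lborel Y (normal_density m \<sigma>)))"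

text \<open>A process is a map \<open>X t \<omega>\<close>; only the values at times in the index set \<open>T\<close> matter.
  Joint normality of the finite-dimensional distributions is expressed by the normality
  of all finite linear combinations.\<close>

definition gaussian_process :: "'a measure \<Rightarrow> real set \<Rightarrow> (real \<Rightarrow> 'a \<Rightarrow> real) \<Rightarrow> bool" where
  "gaussian_process M T X \<longleftrightarrow>
     (\<forall>F c. finite F \<and> F \<subseteq> T \<longrightarrow> gaussian_rv M (\<lambda>\<omega>. \<Sum>t\<in>F. c t * X t \<omega>))"

definition as_continuous_paths :: "'a measure \<Rightarrow> real set \<Rightarrow> (real \<Rightarrow> 'a \<Rightarrow> real) \<Rightarrow> bool" where
  "as_continuous_paths M T X \<longleftrightarrow> (AE \<omega> in M. continuous_on T (\<lambda>t. X t \<omega>))"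

text \<open>\<open>Y\<close> is a copy of the (almost surely continuous) process \<open>X\<close>, possibly on another
  probability space: equality of the laws on the product \<open>\<sigma>\<close>-algebra means equality of all
  finite-dimensional distributions. Path continuity is not determined by that law, and is
  required of the copy as well.\<close>

definition process_copy ::
  "'a measure \<Rightarrow> 'b measure \<Rightarrow> real set \<Rightarrow> (real \<Rightarrow> 'a \<Rightarrow> real) \<Rightarrow> (real \<Rightarrow> 'b \<Rightarrow> real) \<Rightarrow> bool" where
  "process_copy M N T Y X \<longleftrightarrow>
     (\<forall>t\<in>T. Y t \<in> borel_measurable M) \<and> as_continuous_paths M T Y \<and>
     distr M (PiM T (\<lambda>_. borel)) (\<lambda>\<omega>. \<lambda>t\<in>T. Y t \<omega>) =
     distr N (PiM T (\<lambda>_. borel)) (\<lambda>\<omega>. \<lambda>t\<in>T. X t \<omega>)"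

definition independent_copies ::
  "'a measure \<Rightarrow> 'b measure \<Rightarrow> real set \<Rightarrow> 'i set \<Rightarrow> ('i \<Rightarrow> real \<Rightarrow> 'a \<Rightarrow> real) \<Rightarrow> (real \<Rightarrow> 'b \<Rightarrow> real) \<Rightarrow> bool" where
  "independent_copies M N T I Y X \<longleftrightarrow>
     (\<forall>i\<in>I. process_copy M N T (Y i) X) \<and>
     prob_space.indep_vars M (\<lambda>_. PiM T (\<lambda>_. borel)) (\<lambda>i \<omega>. \<lambda>t\<in>T. Y i t \<omega>) I"

definition chi_sq :: "nat \<Rightarrow> (nat \<Rightarrow> real) \<Rightarrow> (nat \<Rightarrow> real \<Rightarrow> 'a \<Rightarrow> real) \<Rightarrow> real \<Rightarrow> 'a \<Rightarrow> real" where
  "chi_sq n b X t \<omega> = (\<Sum>i=1..n. (b i)\<^sup>2 * (X i t \<omega>)\<^sup>2)"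

section \<open>Regular variation\<close>

definition regularly_varying_at_0 :: "real \<Rightarrow> (real \<Rightarrow> real) \<Rightarrow> bool" where
  "regularly_varying_at_0 \<rho> K \<longleftrightarrow>
     set_borel_measurable borel {0<..} K \<and>
     (\<forall>\<^sub>F t in at_right 0. 0 < K t) \<and>
     (\<forall>l>0. ((\<lambda>t. K (l * t) / K t) \<longlongrightarrow> l powr \<rho>) (at_right 0))"

text \<open>The restriction of \<open>K\<close> to a right neighbourhood of 0 has an inverse at the point
  \<open>u\<^sup>-\<^sup>1\<^sup>/\<^sup>2\<close> for all large \<open>u\<close>.\<close>

definition inverse_exists_asymptotically :: "(real \<Rightarrow> real) \<Rightarrow> bool" where
  "inverse_exists_asymptotically K \<longleftrightarrow>
     (\<exists>\<delta>>0. \<forall>\<^sub>F u in at_top. \<exists>!t. 0 < t \<and> t < \<delta> \<and> K t = u powr (-1/2))"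

section \<open>The time change, the partition and the conditions\<close>

definition time_change :: "real \<Rightarrow> (real \<Rightarrow> real) \<Rightarrow> real \<Rightarrow> real" where
  "time_change \<alpha> C t = (LBINT s=ereal (1/2)..ereal t. C s powr (1/\<alpha>))"

text \<open>The endpoint \<open>S\<close> is always 0 or 1.\<close>

definition endpoint_value :: "(real \<Rightarrow> real) \<Rightarrow> real \<Rightarrow> ereal" where
  "endpoint_value f S = Lim (at S within {0<..<1}) (\<lambda>t. ereal (f t))"

definition partition_point :: "(real \<Rightarrow> real) \<Rightarrow> real \<Rightarrow> real \<Rightarrow> nat \<Rightarrow> real" where
  "partition_point f S d j =
     the_inv_into {0<..<1} f (if S = 1 then real j * d else - (real j * d))"

text \<open>Meaningful for \<open>j \<ge> 1\<close> only.\<close>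

definition partition_interval :: "(real \<Rightarrow> real) \<Rightarrow> real \<Rightarrow> real \<Rightarrow> nat \<Rightarrow> real set" where
  "partition_interval f S d j =
     (if S = 1 then {partition_point f S d (j - 1) .. partition_point f S d j}
      else {partition_point f S d j .. partition_point f S d (j - 1)})"

definition distinct_pairs :: "real set \<Rightarrow> (real \<times> real) set" where
  "distinct_pairs D = {(t, s). t \<in> D \<and> s \<in> D \<and> t \<noteq> s}"

definition condition_A :: "(real \<Rightarrow> real) \<Rightarrow> real \<Rightarrow> bool" where
  "condition_A w S \<longleftrightarrow>
     (\<exists>\<delta>>0. mono_on ({0<..<1} \<inter> ball S \<delta>) (\<lambda>t. (w t)\<^sup>2) \<or>
            antimono_on ({0<..<1} \<inter> ball S \<delta>) (\<lambda>t. (w t)\<^sup>2)) \<and>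
     filterlim (\<lambda>t. (w t)\<^sup>2) at_top (at S within {0<..<1})"

text \<open>Suprema and infima are taken in the extended reals.\<close>

definition condition_B ::
  "real \<Rightarrow> nat \<Rightarrow> (real \<Rightarrow> real) \<Rightarrow> (real \<Rightarrow> real) \<Rightarrow> (real \<Rightarrow> real \<Rightarrow> real) \<Rightarrow> real \<Rightarrow> bool" where
  "condition_B \<alpha> k K f r S \<longleftrightarrow>
     (\<exists>d\<^sub>0>0. limsup (\<lambda>j. SUP (t, s)\<in>distinct_pairs (partition_interval f S d\<^sub>0 j).
        ereal ((1 - r t s) / (K \<bar>f t - f s\<bar>)\<^sup>2)) < \<infinity>) \<and>
     (\<alpha> = 2 \<and> k = 1 \<longrightarrow> (\<lambda>t. (K \<bar>t\<bar>)\<^sup>2) \<in> O[at 0](\<lambda>t. t\<^sup>2))"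

definition condition_C ::
  "(real \<Rightarrow> real) \<Rightarrow> (real \<Rightarrow> real) \<Rightarrow> (real \<Rightarrow> real \<Rightarrow> real) \<Rightarrow> real \<Rightarrow> bool" where
  "condition_C K f r S \<longleftrightarrow>
     (\<exists>d\<^sub>0>0.
        0 < liminf (\<lambda>j. INF (t, s)\<in>distinct_pairs (partition_interval f S d\<^sub>0 j).
              ereal ((1 - r t s) / (K \<bar>f t - f s\<bar>)\<^sup>2)) \<and>
        (\<exists>j\<^sub>0\<ge>1. \<exists>l\<^sub>0\<ge>1. \<exists>M\<^sub>0>0. \<exists>\<beta>>0. \<forall>j\<ge>j\<^sub>0. \<forall>l\<ge>l\<^sub>0.
           (SUP (s, t)\<in>partition_interval f S d\<^sub>0 (j + l) \<times> partition_interval f S d\<^sub>0 j.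
              ereal \<bar>r s t\<bar>) < ereal (M\<^sub>0 * real l powr (- \<beta>))))"

definition half_interval :: "real \<Rightarrow> real set" where
  "half_interval S = (if S = 0 then {0<..1/2} else {1/2..<1})"

text \<open>The integrand is nonnegative, so the absolute value of the oriented integral from 1/2
  to \<open>S\<close> is the integral over the half interval, with values in the extended reals.\<close>

definition J_integral ::
  "real \<Rightarrow> (real \<Rightarrow> real) \<Rightarrow> real \<Rightarrow> (real \<Rightarrow> real) \<Rightarrow> real \<Rightarrow> ennreal" where
  "J_integral \<alpha> C c w S =
     (\<integral>\<^sup>+t\<in>half_interval S. ennreal (C t powr (1/\<alpha>) * exp (- c * (w t)\<^sup>2)) \<partial>lborel)"

end

theory Submission
  imports Defs "HOL-Real_Asymp.Real_Asymp" "HOL-Library.Discrete_Functions"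
begin

text \<open>In the time scale \<open>u = \<bar>f t\<bar>\<close> the half interval becomes the half-line \<open>{0..}\<close>, the partition becomes the
  grid of multiples of \<open>d\<close>, and the weight \<open>v u = w\<^sup>2\<close> is eventually nondecreasing. Every grid cell has mass
  \<open>d\<close> under \<open>C t powr (1 / \<alpha>)\<close>, so \<open>J\<close> is finite for a given \<open>c\<close> if and only if \<open>exp (- c * v (d * j))\<close> is
  summable over \<open>j\<close> (\<open>J_integral_finite_iff\<close>). It remains to compare this series with the paths.

  If the series converges, each copy is dominated by the weight (\<open>almost_surely_bounded_by_weight\<close>). By
  condition B and regular variation of \<open>K\<close>, the standard deviations of the dyadic increments inside a cell
  decay geometrically with the level, uniformly in the cell. Chaining therefore shows that the supremum over
  the \<open>j\<close>-th cell exceeds a multiple of \<open>sqrt (v (d * j))\<close> with probability of order \<open>exp (- c * v (d * j))\<close>,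
  and the lemma of Borel and Cantelli applies. The chi-square process is a finite combination of the squares.

  Conversely, the chi-square process dominates the square of the first copy. If that copy is dominated by a
  multiple of the weight, then by condition C the paths at \<open>g\<close> grid points at mutual distance at least \<open>g\<close>
  are almost uncorrelated, and a second moment computation for a sum of exponentials shows that their maximum
  is likely to exceed a multiple of \<open>sqrt (ln g)\<close> (\<open>prob_all_below\<close>). As these points lie below index \<open>g\<^sup>2\<close>,
  the weight grows at least logarithmically in the index, and for large \<open>c\<close> the series converges
  (\<open>weight_summable_if_bounded\<close>). The freedom in \<open>c\<close> absorbs all multiplicative constants in front of the
  weight.\<close>

section \<open>Dyadic chaining and regular variation\<close>

lemma dyadic_grid_bound:
  fixes g :: "real \<Rightarrow> real"
  assumes incr: "\<And>m i. i < 2 ^ m \<Longrightarrow>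
      \<bar>g (a + d * real (Suc i) / 2 ^ m) - g (a + d * real i / 2 ^ m)\<bar> \<le> y m"
    and "i \<le> 2 ^ m"
  shows "\<bar>g (a + d * real i / 2 ^ m) - g a\<bar> \<le> (\<Sum>l\<le>m. y l)"
  using \<open>i \<le> 2 ^ m\<close>
proof (induction m arbitrary: i)
  case 0
  then have "i = 0 \<or> i = 1" by auto
  then show ?case using incr[of 0 0] by auto
next
  case (Suc m)
  have half: "\<bar>g (a + d * real (2 * k) / 2 ^ Suc m) - g a\<bar> \<le> (\<Sum>l\<le>m. y l)" if "k \<le> 2 ^ m" for k
    using Suc.IH[OF that] by simp
  show ?case
  proof (cases "even i")
    case True
    then obtain k where k: "i = 2 * k" by blast
    have "0 \<le> y (Suc m)" by (rule order_trans[OF abs_ge_zero incr[of 0 "Suc m"]]) simp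
    then show ?thesis using half[of k] Suc.prems k by simp
  next
    case False
    then obtain k where k: "i = Suc (2 * k)" by (metis oddE Suc_eq_plus1)
    have "2 * k < 2 * 2 ^ m" using Suc.prems k by simp
    then have "\<bar>g (a + d * real (2 * k) / 2 ^ Suc m) - g a\<bar> \<le> (\<Sum>l\<le>m. y l)"
      by (intro half) simp
    moreover have "\<bar>g (a + d * real i / 2 ^ Suc m) - g (a + d * real (2 * k) / 2 ^ Suc m)\<bar> \<le> y (Suc m)"
      unfolding k using \<open>2 * k < 2 * 2 ^ m\<close> by (intro incr) simp
    ultimately show ?thesis by simp
  qed
qed

text \<open>Each grid point of level \<open>m + 1\<close> is at most one step of that level away from a grid point of
  level \<open>m\<close>; continuity carries the resulting bound from the dense dyadic grid to all points.\<close>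

lemma dyadic_chaining:
  fixes g :: "real \<Rightarrow> real"
  assumes "0 < d" and cont: "continuous_on {a..a + d} g"
    and incr: "\<And>m i. i < 2 ^ m \<Longrightarrow>
      \<bar>g (a + d * real (Suc i) / 2 ^ m) - g (a + d * real i / 2 ^ m)\<bar> \<le> y m"
    and y: "summable y" and u: "u \<in> {a..a + d}"
  shows "\<bar>g u - g a\<bar> \<le> suminf y"
proof -
  define z where "z = (u - a) / d"
  have z: "0 \<le> z" "z \<le> 1" "u = a + d * z"
    using u \<open>0 < d\<close> by (auto simp: z_def field_simps)
  define i where "i m = nat \<lfloor>z * 2 ^ m\<rfloor>" for m
  have i_real: "real (i m) = real_of_int \<lfloor>z * 2 ^ m\<rfloor>" for m
    using z by (simp add: i_def)
  have i_le: "i m \<le> 2 ^ m" for m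
  proof -
    have "real (i m) \<le> z * 2 ^ m" by (simp add: i_real)
    also have "\<dots> \<le> 2 ^ m" using z by simp
    finally show ?thesis by (simp flip: of_nat_le_iff)
  qed
  define p where "p m = a + d * real (i m) / 2 ^ m" for m
  have y_nonneg: "0 \<le> y m" for m
    by (rule order_trans[OF abs_ge_zero incr[of 0 m]]) simp
  have "(\<lambda>m. real (i m) / 2 ^ m) \<longlonglongrightarrow> z"
  proof (rule tendsto_sandwich[where f = "\<lambda>m. z - 1 / 2 ^ m" and h = "\<lambda>m. z"])
    have "z - 1 / 2 ^ m \<le> real (i m) / 2 ^ m" for m
    proof -
      have "(z * 2 ^ m - 1) / 2 ^ m \<le> real (i m) / 2 ^ m"
        unfolding i_real by (intro divide_right_mono) (linarith, simp)
      then show ?thesis by (simp add: diff_divide_distrib)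
    qed
    then show "\<forall>\<^sub>F m in sequentially. z - 1 / 2 ^ m \<le> real (i m) / 2 ^ m"
      by (intro always_eventually allI)
    show "\<forall>\<^sub>F m in sequentially. real (i m) / 2 ^ m \<le> z"
      unfolding i_real by (intro always_eventually allI) (simp add: field_simps)
    show "(\<lambda>m. z - 1 / 2 ^ m) \<longlonglongrightarrow> z" by real_asymp
  qed simp
  then have "p \<longlonglongrightarrow> u"
    unfolding p_def z(3) times_divide_eq_right[symmetric] by (intro tendsto_intros)
  moreover have p_in: "p m \<in> {a..a + d}" for m
  proof -
    have "real (i m) / 2 ^ m \<le> 1" using i_le[of m]
      by (simp add: of_nat_le_iff[of "i m" "2 ^ m", where ?'a=real, simplified])
    then have "d * (real (i m) / 2 ^ m) \<le> d * 1" using \<open>0 < d\<close> by (intro mult_left_mono) auto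
    then show ?thesis using \<open>0 < d\<close> by (simp add: p_def)
  qed
  ultimately have "(\<lambda>m. g (p m)) \<longlonglongrightarrow> g u"
    using cont u by (intro continuous_on_tendsto_compose[OF cont]) auto
  then have "(\<lambda>m. \<bar>g (p m) - g a\<bar>) \<longlonglongrightarrow> \<bar>g u - g a\<bar>" by (intro tendsto_intros)
  moreover have "\<bar>g (p m) - g a\<bar> \<le> suminf y" for m
  proof -
    have "\<bar>g (p m) - g a\<bar> \<le> (\<Sum>l\<le>m. y l)"
      unfolding p_def by (rule dyadic_grid_bound[OF incr i_le])
    also have "\<dots> \<le> suminf y" using y y_nonneg by (intro sum_le_suminf) auto
    finally show ?thesis .
  qed
  ultimately show ?thesis by (intro LIMSEQ_le_const2) auto
qed

text \<open>Since \<open>K (t / 2) / K t\<close> tends to \<open>2 powr - \<rho> < 1\<close>, the values of \<open>K\<close> along a dyadic sequence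
  eventually shrink by a fixed factor at every step; a larger constant \<open>D\<close> absorbs the first terms.\<close>

lemma regularly_varying_dyadic_decay:
  assumes rv: "regularly_varying_at_0 \<rho> K" and pos: "\<And>t. 0 < t \<Longrightarrow> 0 < K t"
    and "0 < \<rho>" "0 < d"
  obtains D \<theta> where "0 < D" "0 < \<theta>" "\<theta> < 1" "\<And>m::nat. K (d / 2 ^ m) \<le> D * \<theta> ^ m"
proof -
  define q where "q = (1 / 2) powr \<rho>"
  have q: "0 < q" "q < 1"
    using powr_less_mono2[of \<rho> "1/2" 1] \<open>0 < \<rho>\<close> by (auto simp: q_def)
  define \<theta> where "\<theta> = (1 + q) / 2"
  have \<theta>: "q < \<theta>" "0 < \<theta>" "\<theta> < 1" using q by (auto simp: \<theta>_def)
  have lim: "((\<lambda>t. K (1 / 2 * t) / K t) \<longlongrightarrow> q) (at_right 0)"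
    using rv unfolding regularly_varying_at_0_def q_def by (auto dest: spec[of _ "1/2"])
  have "filterlim (\<lambda>m::nat. d / 2 ^ m) (at_right 0) sequentially"
    using \<open>0 < d\<close> by real_asymp
  from filterlim_compose[OF lim this]
  have "\<forall>\<^sub>F m in sequentially. K (1 / 2 * (d / 2 ^ m)) / K (d / 2 ^ m) < \<theta>"
    using \<theta>(1) by (intro order_tendstoD(2)) auto
  then obtain m0 where m0: "\<And>m. m \<ge> m0 \<Longrightarrow> K (1 / 2 * (d / 2 ^ m)) / K (d / 2 ^ m) < \<theta>"
    by (auto simp: eventually_sequentially)
  have shrink: "K (d / 2 ^ Suc m) \<le> \<theta> * K (d / 2 ^ m)" if "m \<ge> m0" for m
    using m0[OF that] pos[of "d / 2 ^ m"] \<open>0 < d\<close> by (simp add: field_simps)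
  define D where "D = (\<Sum>m\<le>m0. K (d / 2 ^ m) / \<theta> ^ m)"
  have terms: "0 < K (d / 2 ^ m) / \<theta> ^ m" for m
    using pos[of "d / 2 ^ m"] \<open>0 < d\<close> \<theta> by simp
  have small: "K (d / 2 ^ m) \<le> D * \<theta> ^ m" if "m \<le> m0" for m
  proof -
    have "K (d / 2 ^ m) / \<theta> ^ m \<le> D"
      unfolding D_def using that terms by (intro member_le_sum) (auto intro: less_imp_le)
    then show ?thesis using \<theta> by (simp add: field_simps)
  qed
  have "K (d / 2 ^ m) \<le> D * \<theta> ^ m" for m
  proof (cases "m \<le> m0")
    case False
    then have "m0 \<le> m" by simp
    then show ?thesis
    proof (induction m rule: dec_induct)
      case base
      then show ?case by (intro small) simp
    next
      case (step m)
      have "K (d / 2 ^ Suc m) \<le> \<theta> * K (d / 2 ^ m)" by (rule shrink) (rule step)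
      also have "\<dots> \<le> \<theta> * (D * \<theta> ^ m)" using step \<theta> by (intro mult_left_mono) auto
      finally show ?case by (simp add: algebra_simps)
    qed
  qed (rule small)
  moreover have "0 < D" unfolding D_def by (intro sum_pos terms) auto
  ultimately show ?thesis using that \<theta> by blast
qed

section \<open>Exponential moments of Gaussian variables\<close>

text \<open>Multiplying the density of \<open>N(0, \<sigma>\<^sup>2)\<close> by \<open>exp x\<close> gives \<open>exp (\<sigma>\<^sup>2 / 2)\<close> times the density of
  \<open>N(\<sigma>\<^sup>2, \<sigma>\<^sup>2)\<close>.\<close>

lemma normal_density_exp_tilt:
  assumes "0 < \<sigma>"
  shows "normal_density 0 \<sigma> x * exp x = exp (\<sigma>\<^sup>2 / 2) * normal_density (\<sigma>\<^sup>2) \<sigma> x"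
proof -
  have "- x\<^sup>2 / (2 * \<sigma>\<^sup>2) + x = \<sigma>\<^sup>2 / 2 - (x - \<sigma>\<^sup>2)\<^sup>2 / (2 * \<sigma>\<^sup>2)"
    using assms by (simp add: field_simps power2_eq_square)
  then have "exp (- x\<^sup>2 / (2 * \<sigma>\<^sup>2)) * exp x = exp (\<sigma>\<^sup>2 / 2) * exp (- (x - \<sigma>\<^sup>2)\<^sup>2 / (2 * \<sigma>\<^sup>2))"
    by (simp flip: exp_add)
  then show ?thesis by (simp add: normal_density_def)
qed

lemma (in prob_space) gaussian_rv_integrable_square:
  assumes "gaussian_rv M Z"
  shows "integrable M (\<lambda>\<omega>. (Z \<omega>)\<^sup>2)"
proof -
  have [measurable]: "Z \<in> borel_measurable M" using assms by (simp add: gaussian_rv_def)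
  consider m where "AE \<omega> in M. Z \<omega> = m"
    | m \<sigma> where "0 < \<sigma>" "distributed M lborel Z (normal_density m \<sigma>)"
    using assms unfolding gaussian_rv_def by blast
  then show ?thesis
  proof cases
    case 1
    then have "integrable M (\<lambda>\<omega>. (Z \<omega>)\<^sup>2) \<longleftrightarrow> integrable M (\<lambda>_. m\<^sup>2)"
      by (intro integrable_cong_AE) auto
    then show ?thesis by simp
  next
    case 2
    have "integrable lborel (\<lambda>x. normal_density m \<sigma> x * (x - m) ^ 2 + 
        (2 * m) * (normal_density m \<sigma> x * (x - m) ^ 1) + m\<^sup>2 * normal_density m \<sigma> x)"
      by (intro Bochner_Integration.integrable_add integrable_mult_right integrable_normal_moment
          integrable_normal_density \<open>0 < \<sigma>\<close>)
    also have "(\<lambda>x. normal_density m \<sigma> x * (x - m) ^ 2 +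
        (2 * m) * (normal_density m \<sigma> x * (x - m) ^ 1) + m\<^sup>2 * normal_density m \<sigma> x) =
        (\<lambda>x. normal_density m \<sigma> x * x\<^sup>2)"
      by (auto simp: fun_eq_iff algebra_simps power2_eq_square)
    finally show ?thesis using distributed_integrable[OF 2(2), of "\<lambda>x. x\<^sup>2"] by simp
  qed
qed

lemma (in prob_space) gaussian_rv_exp_moment:
  assumes gauss: "gaussian_rv M Z" and mean: "expectation Z = 0"
  shows "integrable M (\<lambda>\<omega>. exp (Z \<omega>))"
    and "expectation (\<lambda>\<omega>. exp (Z \<omega>)) = exp (expectation (\<lambda>\<omega>. (Z \<omega>)\<^sup>2) / 2)"
proof -
  have [measurable]: "Z \<in> borel_measurable M" using gauss by (simp add: gaussian_rv_def)
  consider m where "AE \<omega> in M. Z \<omega> = m"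
    | m \<sigma> where "0 < \<sigma>" "distributed M lborel Z (normal_density m \<sigma>)"
    using gauss unfolding gaussian_rv_def by blast
  then have "integrable M (\<lambda>\<omega>. exp (Z \<omega>)) \<and>
    expectation (\<lambda>\<omega>. exp (Z \<omega>)) = exp (expectation (\<lambda>\<omega>. (Z \<omega>)\<^sup>2) / 2)"
  proof cases
    case 1
    have "expectation Z = expectation (\<lambda>_. m)" using 1 by (intro integral_cong_AE) auto
    then have "m = 0" using mean by (simp add: prob_space)
    then have 0: "AE \<omega> in M. Z \<omega> = 0" using 1 by simp
    have "expectation (\<lambda>\<omega>. (Z \<omega>)\<^sup>2) = expectation (\<lambda>_. 0)"
      by (rule integral_cong_AE) (use 0 in auto)
    moreover have "expectation (\<lambda>\<omega>. exp (Z \<omega>)) = expectation (\<lambda>_. 1)"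
      by (rule integral_cong_AE) (use 0 in auto)
    moreover have "integrable M (\<lambda>\<omega>. exp (Z \<omega>)) \<longleftrightarrow> integrable M (\<lambda>_. 1::real)"
      by (rule integrable_cong_AE) (use 0 in auto)
    ultimately show ?thesis by (simp add: prob_space)
  next
    case 2
    have "expectation Z = m" by (rule normal_distributed_expectation[OF 2])
    then have "m = 0" using mean by simp
    note D = 2(2)[unfolded this]
    have "variance Z = \<sigma>\<^sup>2" by (rule normal_distributed_variance[OF 2])
    then have var: "expectation (\<lambda>\<omega>. (Z \<omega>)\<^sup>2) = \<sigma>\<^sup>2" using mean by simp
    have "integrable lborel (\<lambda>x. normal_density 0 \<sigma> x * exp x)"
      unfolding normal_density_exp_tilt[OF 2(1)]
      by (intro integrable_mult_right integrable_normal_density 2(1))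
    then have int: "integrable M (\<lambda>\<omega>. exp (Z \<omega>))"
      using distributed_integrable[OF D, of exp] by simp
    have "expectation (\<lambda>\<omega>. exp (Z \<omega>)) = (\<integral>x. normal_density 0 \<sigma> x * exp x \<partial>lborel)"
      using distributed_integral[OF D, of exp] by simp
    also have "\<dots> = exp (\<sigma>\<^sup>2 / 2)"
      unfolding normal_density_exp_tilt[OF 2(1)] using 2(1) by simp
    finally show ?thesis using int var by simp
  qed
  then show "integrable M (\<lambda>\<omega>. exp (Z \<omega>))"
    "expectation (\<lambda>\<omega>. exp (Z \<omega>)) = exp (expectation (\<lambda>\<omega>. (Z \<omega>)\<^sup>2) / 2)" by auto
qed

text \<open>Markov's inequality for \<open>exp (\<plusminus> y W / s\<^sup>2)\<close>.\<close>

lemma (in prob_space) subgaussian_tail: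
  assumes [measurable]: "random_variable borel W"
    and int: "\<And>l. integrable M (\<lambda>\<omega>. exp (l * W \<omega>))"
    and mgf: "\<And>l. expectation (\<lambda>\<omega>. exp (l * W \<omega>)) \<le> exp (l\<^sup>2 * s\<^sup>2 / 2)"
    and "0 < s" "0 \<le> y"
  shows "prob {\<omega>\<in>space M. y < \<bar>W \<omega>\<bar>} \<le> 2 * exp (- (y\<^sup>2) / (2 * s\<^sup>2))"
proof -
  define l where "l = y / s\<^sup>2"
  have one_sided: "prob {\<omega>\<in>space M. y < e * W \<omega>} \<le> exp (- (y\<^sup>2) / (2 * s\<^sup>2))"
    if "e = 1 \<or> e = -1" for e :: real
  proof -
    have "prob {\<omega>\<in>space M. y < e * W \<omega>} \<le> prob {\<omega>\<in>space M. exp (l * y) \<le> exp ((l * e) * W \<omega>)}"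
      using \<open>0 \<le> y\<close> \<open>0 < s\<close>
      by (intro finite_measure_mono) (auto simp: l_def mult.assoc intro!: divide_right_mono mult_left_mono)
    also have "\<dots> \<le> expectation (\<lambda>\<omega>. exp ((l * e) * W \<omega>)) / exp (l * y)"
      by (rule integral_Markov_inequality_measure[where A = "{}"]) (use int in auto)
    also have "\<dots> \<le> exp ((l * e)\<^sup>2 * s\<^sup>2 / 2) / exp (l * y)"
      by (intro divide_right_mono mgf) simp
    also have "\<dots> = exp ((l * e)\<^sup>2 * s\<^sup>2 / 2 - l * y)" by (simp add: exp_diff)
    also have "(l * e)\<^sup>2 * s\<^sup>2 / 2 - l * y = - (y\<^sup>2) / (2 * s\<^sup>2)"
      using that \<open>0 < s\<close> by (auto simp: l_def field_simps power2_eq_square)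
    finally show ?thesis .
  qed
  have "{\<omega>\<in>space M. y < \<bar>W \<omega>\<bar>} = {\<omega>\<in>space M. y < 1 * W \<omega>} \<union> {\<omega>\<in>space M. y < -1 * W \<omega>}"
    by auto
  also have "prob \<dots> \<le> prob {\<omega>\<in>space M. y < 1 * W \<omega>} + prob {\<omega>\<in>space M. y < -1 * W \<omega>}"
    by (intro measure_Un_le) measurable
  finally show ?thesis using one_sided[of 1] one_sided[of "-1"] by linarith
qed

section \<open>Gaussian processes on the half-line\<close>

text \<open>Tail bounds for increments and second moments of exponential sums both follow from the exponential
  moments of pairs, which therefore serve as the interface to joint normality.\<close>

locale half_line_gaussian = prob_space M for M :: "'a measure" +
  fixes Z :: "real \<Rightarrow> 'a \<Rightarrow> real" and \<rho> :: "real \<Rightarrow> real \<Rightarrow> real"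
  assumes Z_measurable: "0 \<le> u \<Longrightarrow> random_variable borel (Z u)"
    and \<rho>_sym: "0 \<le> u \<Longrightarrow> 0 \<le> u' \<Longrightarrow> \<rho> u u' = \<rho> u' u"
    and \<rho>_diag: "0 \<le> u \<Longrightarrow> \<rho> u u = 1"
    and exp_integrable: "0 \<le> u \<Longrightarrow> 0 \<le> u' \<Longrightarrow> integrable M (\<lambda>\<omega>. exp (p * Z u \<omega> + q * Z u' \<omega>))"
    and exp_moment: "0 \<le> u \<Longrightarrow> 0 \<le> u' \<Longrightarrow>
      expectation (\<lambda>\<omega>. exp (p * Z u \<omega> + q * Z u' \<omega>)) = exp ((p\<^sup>2 + q\<^sup>2 + 2 * p * q * \<rho> u u') / 2)"
begin

lemma value_tail:
  assumes "0 \<le> u" "0 \<le> y"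
  shows "prob {\<omega>\<in>space M. y < \<bar>Z u \<omega>\<bar>} \<le> 2 * exp (- (y\<^sup>2) / 2)"
  using subgaussian_tail[of "Z u" 1 y] Z_measurable[of u] assms
    exp_integrable[of u u _ 0] exp_moment[of u u _ 0] by simp

lemma increment_tail:
  assumes "0 \<le> u" "0 \<le> u'" "2 * (1 - \<rho> u u') \<le> s\<^sup>2" "0 < s" "0 \<le> y"
  shows "prob {\<omega>\<in>space M. s * y < \<bar>Z u \<omega> - Z u' \<omega>\<bar>} \<le> 2 * exp (- (y\<^sup>2) / 2)"
proof -
  have "prob {\<omega>\<in>space M. s * y < \<bar>Z u \<omega> - Z u' \<omega>\<bar>} \<le> 2 * exp (- ((s * y)\<^sup>2) / (2 * s\<^sup>2))"
  proof (rule subgaussian_tail)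
    show "random_variable borel (\<lambda>\<omega>. Z u \<omega> - Z u' \<omega>)"
      using Z_measurable assms by measurable
    have eq: "exp (l * (Z u \<omega> - Z u' \<omega>)) = exp (l * Z u \<omega> + (- l) * Z u' \<omega>)" for l \<omega>
      by (simp add: algebra_simps)
    show "integrable M (\<lambda>\<omega>. exp (l * (Z u \<omega> - Z u' \<omega>)))" for l
      unfolding eq using assms by (intro exp_integrable)
    show "expectation (\<lambda>\<omega>. exp (l * (Z u \<omega> - Z u' \<omega>))) \<le> exp (l\<^sup>2 * s\<^sup>2 / 2)" for l
    proof -
      have "l\<^sup>2 + (- l)\<^sup>2 + 2 * l * (- l) * \<rho> u u' = l\<^sup>2 * (2 * (1 - \<rho> u u'))"
        by (simp add: algebra_simps power2_eq_square)
      also have "\<dots> \<le> l\<^sup>2 * s\<^sup>2" using assms by (intro mult_left_mono) auto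
      finally show ?thesis unfolding eq using assms by (subst exp_moment) auto
    qed
  qed (use assms in auto)
  also have "(s * y)\<^sup>2 / (2 * s\<^sup>2) = y\<^sup>2 / 2" using \<open>0 < s\<close> by (simp add: power_mult_distrib)
  then have "- ((s * y)\<^sup>2) / (2 * s\<^sup>2) = - (y\<^sup>2) / 2" by simp
  finally show ?thesis .
qed

lemma prob_countable_Union_le:
  assumes [measurable]: "\<And>m::nat. A m \<in> sets M"
    and le: "\<And>m. prob (A m) \<le> B m" and "summable B"
  shows "prob (\<Union>m. A m) \<le> suminf B"
proof -
  have "summable (\<lambda>m. prob (A m))"
    using \<open>summable B\<close> le by (intro summable_comparison_test'[of B 0 "\<lambda>m. prob (A m)"]) auto
  moreover from this have "prob (\<Union>m. A m) \<le> (\<Sum>m. prob (A m))"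
    by (intro finite_measure_subadditive_countably) auto
  ultimately show ?thesis using suminf_le[OF le] \<open>summable B\<close> by fastforce
qed

text \<open>Outside this event, chaining bounds the path on the \<open>j\<close>-th cell \<open>{d * j..d * j + d}\<close>. Here \<open>s m\<close> stands
  for a bound on the standard deviation of a step of level \<open>m\<close>, and the summand \<open>2 * (m + 1)\<close> leaves room
  for the number \<open>2 ^ m\<close> of such steps.\<close>

definition cell_overflow :: "real \<Rightarrow> (nat \<Rightarrow> real) \<Rightarrow> real \<Rightarrow> nat \<Rightarrow> 'a set" where
  "cell_overflow d s a j =
     {\<omega>\<in>space M. a < \<bar>Z (d * real j) \<omega>\<bar>} \<union>
     (\<Union>m. \<Union>i\<in>{..<2 ^ m}. {\<omega>\<in>space M. s m * (a + 2 * real (Suc m)) <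
        \<bar>Z (d * real j + d * real (Suc i) / 2 ^ m) \<omega> - Z (d * real j + d * real i / 2 ^ m) \<omega>\<bar>})"

lemma cell_overflow_sets:
  assumes "0 < d" shows "cell_overflow d s a j \<in> sets M"
proof -
  have [measurable]: "random_variable borel (Z (d * real j))"
    "random_variable borel (Z (d * real j + d * real i / 2 ^ m))" for i m
    using assms by (auto intro!: Z_measurable add_nonneg_nonneg mult_nonneg_nonneg divide_nonneg_nonneg)
  show ?thesis unfolding cell_overflow_def by measurable
qed

text \<open>As \<open>(a + 2 * (m + 1))\<^sup>2 \<ge> a\<^sup>2 + 4 * m\<close>, each step of level \<open>m\<close> overflows with probability at most
  \<open>2 * exp (- a\<^sup>2 / 2) * exp (- 2 * m)\<close>, and \<open>exp (- 2 * m)\<close> beats the factor \<open>2 ^ m\<close> in the union bound.\<close>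

lemma prob_cell_overflow:
  assumes "0 < d" "0 \<le> a" and s_pos: "\<And>m. 0 < s m"
    and incr: "\<And>m i. i < 2 ^ m \<Longrightarrow>
      2 * (1 - \<rho> (d * real j + d * real (Suc i) / 2 ^ m) (d * real j + d * real i / 2 ^ m)) \<le> (s m)\<^sup>2"
  shows "prob (cell_overflow d s a j) \<le> 6 * exp (- (a\<^sup>2) / 2)"
proof -
  define step where "step m i = {\<omega>\<in>space M. s m * (a + 2 * real (Suc m)) <
    \<bar>Z (d * real j + d * real (Suc i) / 2 ^ m) \<omega> - Z (d * real j + d * real i / 2 ^ m) \<omega>\<bar>}" for m i
  have nonneg: "0 \<le> d * real j + d * real i / 2 ^ m" for i m
    using \<open>0 < d\<close> by (intro add_nonneg_nonneg mult_nonneg_nonneg divide_nonneg_nonneg) auto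
  have [measurable]: "random_variable borel (Z (d * real j))"
    "random_variable borel (Z (d * real j + d * real i / 2 ^ m))" for i m
    using \<open>0 < d\<close> nonneg by (auto intro!: Z_measurable)
  have step_sets [measurable]: "step m i \<in> sets M" for m i unfolding step_def by measurable
  have step_prob: "prob (step m i) \<le> 2 * (exp (- (a\<^sup>2) / 2) * (1 / 4) ^ m)" if "i < 2 ^ m" for m i
  proof -
    have "prob (step m i) \<le> 2 * exp (- ((a + 2 * real (Suc m))\<^sup>2) / 2)"
      unfolding step_def using that s_pos \<open>0 \<le> a\<close>
      by (intro increment_tail incr nonneg) auto
    also have "\<dots> \<le> 2 * (exp (- (a\<^sup>2) / 2) * exp (- 2 * real m))"
    proof -
      have "(a + 2 * real (Suc m))\<^sup>2 = a\<^sup>2 + 4 * real m + (a * (4 * (1 + real m)) + 4 * (real m)\<^sup>2 + 4 * real m + 4)"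
        by (simp add: power2_eq_square algebra_simps)
      moreover have "0 \<le> a * (4 * (1 + real m)) + 4 * (real m)\<^sup>2 + 4 * real m + 4"
        using \<open>0 \<le> a\<close> by (intro add_nonneg_nonneg mult_nonneg_nonneg) auto
      ultimately have "a\<^sup>2 + 4 * real m \<le> (a + 2 * real (Suc m))\<^sup>2" by linarith
      then have "- ((a + 2 * real (Suc m))\<^sup>2) / 2 \<le> - (a\<^sup>2) / 2 + - 2 * real m" by simp
      then show ?thesis unfolding exp_add[symmetric] by simp
    qed
    also have "exp (- 2 * real m) \<le> (1 / 4) ^ m"
    proof -
      have "(2::real) * 2 \<le> exp 1 * exp 1" using exp_ge_add_one_self[of 1] by (intro mult_mono) auto
      then have "exp (- 2) \<le> (1 / 4 :: real)"
        by (simp add: exp_minus field_simps flip: exp_add)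
      then have "exp (- 2) ^ m \<le> (1 / 4 :: real) ^ m" by (intro power_mono) auto
      then show ?thesis by (simp add: exp_of_nat_mult[symmetric] mult.commute)
    qed
    finally show ?thesis by simp
  qed
  have level: "prob (\<Union>i\<in>{..<2 ^ m}. step m i) \<le> 2 * exp (- (a\<^sup>2) / 2) * (1 / 2) ^ m" for m
  proof -
    have "prob (\<Union>i\<in>{..<2 ^ m}. step m i) \<le> (\<Sum>i\<in>{..<2 ^ m}. prob (step m i))"
      by (intro measure_UNION_le) auto
    also have "\<dots> \<le> of_nat (card {..<2 ^ m :: nat}) * (2 * (exp (- (a\<^sup>2) / 2) * (1 / 4) ^ m))"
      using step_prob by (intro sum_bounded_above) auto
    also have "\<dots> = 2 * exp (- (a\<^sup>2) / 2) * (2 * (1 / 4)) ^ m"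
      by (simp only: power_mult_distrib) simp
    finally show ?thesis by simp
  qed
  have "prob (\<Union>m. \<Union>i\<in>{..<2 ^ m}. step m i) \<le> (\<Sum>m. 2 * exp (- (a\<^sup>2) / 2) * (1 / 2) ^ m)"
    using level by (intro prob_countable_Union_le) (auto intro!: summable_mult summable_geometric)
  also have "\<dots> = 4 * exp (- (a\<^sup>2) / 2)"
    by (subst suminf_mult) (auto simp: suminf_geometric)
  finally have "prob (\<Union>m. \<Union>i\<in>{..<2 ^ m}. step m i) \<le> 4 * exp (- (a\<^sup>2) / 2)" .
  moreover have "prob {\<omega>\<in>space M. a < \<bar>Z (d * real j) \<omega>\<bar>} \<le> 2 * exp (- (a\<^sup>2) / 2)"
    using \<open>0 < d\<close> \<open>0 \<le> a\<close> by (intro value_tail) auto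
  moreover have "prob (cell_overflow d s a j) \<le> prob {\<omega>\<in>space M. a < \<bar>Z (d * real j) \<omega>\<bar>} +
      prob (\<Union>m. \<Union>i\<in>{..<2 ^ m}. step m i)"
    unfolding cell_overflow_def step_def[symmetric] by (intro measure_Un_le) measurable
  ultimately show ?thesis by simp
qed

text \<open>Borel--Cantelli with \<open>a = sqrt (2 c v (d j))\<close> leaves only finitely many overflowing cells; on the
  compact set that they cover, continuity of the path suffices.\<close>

theorem almost_surely_bounded_by_weight:
  assumes "0 < d" "0 < D" "0 < \<theta>" "\<theta> < 1"
    and paths: "AE \<omega> in M. continuous_on {0..} (\<lambda>u. Z u \<omega>)"
    and incr: "\<And>j m i. j1 \<le> j \<Longrightarrow> i < 2 ^ m \<Longrightarrow>
      2 * (1 - \<rho> (d * real j + d * real (Suc i) / 2 ^ m) (d * real j + d * real i / 2 ^ m)) \<le> (D * \<theta> ^ m)\<^sup>2"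
    and v_cont: "continuous_on {0..} v" and v_pos: "\<And>u. 0 \<le> u \<Longrightarrow> 0 < v u"
    and v_mono: "\<And>u u'. U \<le> u \<Longrightarrow> u \<le> u' \<Longrightarrow> v u \<le> v u'"
    and "0 < c" and sum: "summable (\<lambda>j. exp (- c * v (d * real j)))"
  shows "AE \<omega> in M. \<exists>B. \<forall>u\<ge>0. (Z u \<omega>)\<^sup>2 \<le> B * v u"
proof -
  define a where "a j = sqrt (2 * c * v (d * real j))" for j
  define s where "s m = D * \<theta> ^ m" for m :: nat
  have v_grid: "0 < v (d * real j)" for j using v_pos \<open>0 < d\<close> by simp
  have a_sq: "(a j)\<^sup>2 = 2 * c * v (d * real j)" and a_nonneg: "0 \<le> a j" for j
    using v_grid[of j] \<open>0 < c\<close> by (auto simp: a_def)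
  have s_pos: "0 < s m" for m using assms by (simp add: s_def)
  define E where "E j = (if j1 \<le> j then cell_overflow d s (a j) j else {})" for j
  have E_sets: "E j \<in> sets M" for j using cell_overflow_sets[OF \<open>0 < d\<close>] by (simp add: E_def)
  have "prob (E j) \<le> 6 * exp (- c * v (d * real j))" for j
  proof (cases "j1 \<le> j")
    case True
    then have "prob (cell_overflow d s (a j) j) \<le> 6 * exp (- ((a j)\<^sup>2) / 2)"
      using \<open>0 < d\<close> a_nonneg s_pos incr by (intro prob_cell_overflow) (auto simp: s_def)
    then show ?thesis using True by (simp add: E_def a_sq)
  qed (simp add: E_def)
  then have "summable (\<lambda>j. prob (E j))"
    by (intro summable_comparison_test'[OF summable_mult[OF sum, of 6], of 0]) auto
  then have finitely_many: "AE \<omega> in M. \<forall>\<^sub>F j in sequentially. \<omega> \<in> space M - E j"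
    using E_sets by (intro borel_cantelli_AE1) (auto simp: less_top[symmetric])
  define G0 where "G0 = suminf s"
  define G1 where "G1 = suminf (\<lambda>m. s m * (2 * real (Suc m)))"
  have s_sum: "summable s"
    unfolding s_def using assms by (intro summable_mult summable_geometric) auto
  have "summable (\<lambda>m. (2 * D) * (real (Suc m) * \<theta> ^ m))"
    using geometric_deriv_sums[of \<theta>] assms by (intro summable_mult) (auto simp: sums_iff)
  then have s1_sum: "summable (\<lambda>m. s m * (2 * real (Suc m)))"
    by (simp add: s_def mult_ac)
  have chain_sum: "summable (\<lambda>m. s m * (a j + 2 * real (Suc m)))"
    "(\<Sum>m. s m * (a j + 2 * real (Suc m))) = a j * G0 + G1" for j
    unfolding distrib_left G0_def G1_def
    using summable_mult2[OF s_sum] s1_sum suminf_mult2[OF s_sum, of "a j"]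
    by (auto intro!: summable_add simp: suminf_add[symmetric] mult.commute)
  have G: "0 \<le> G0" "0 \<le> G1"
    unfolding G0_def G1_def using s_sum s1_sum s_pos
    by (auto intro!: suminf_nonneg mult_nonneg_nonneg intro: less_imp_le)
  define J0 where "J0 = nat \<lceil>max U 0 / d\<rceil>"
  have J0: "U \<le> d * real j" if "J0 \<le> j" for j
  proof -
    have "max U 0 / d \<le> real j" using that by (simp add: J0_def)
    then show ?thesis using \<open>0 < d\<close> by (simp add: field_simps)
  qed
  define v0 where "v0 = v (d * real J0)"
  \<comment> \<open>The additive constant \<open>G1\<close> is absorbed into a multiple of \<open>sqrt v\<close> because \<open>v \<ge> v0\<close> far out.\<close>
  define B0 where "B0 = sqrt (2 * c) * (1 + G0) + G1 / sqrt v0"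
  have "0 < v0" unfolding v0_def by (rule v_grid)
  have "0 \<le> B0" using G \<open>0 < c\<close> \<open>0 < v0\<close> by (simp add: B0_def)
  have "\<exists>B. \<forall>u\<ge>0. (Z u \<omega>)\<^sup>2 \<le> B * v u"
    if cont: "continuous_on {0..} (\<lambda>u. Z u \<omega>)"
      and ev: "\<forall>\<^sub>F j in sequentially. \<omega> \<in> space M - E j" for \<omega>
  proof -
    obtain J where J: "\<And>j. J \<le> j \<Longrightarrow> \<omega> \<in> space M - E j" "j1 \<le> J" "J0 \<le> J"
      using ev unfolding eventually_sequentially
      by (metis (no_types, opaque_lifting) le_trans max.cobounded1 max.cobounded2 nle_le)
    have far: "(Z u \<omega>)\<^sup>2 \<le> B0\<^sup>2 * v u" if u: "d * real J \<le> u" for u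
    proof -
      define j where "j = nat \<lfloor>u / d\<rfloor>"
      have ud: "real J \<le> u / d" using u \<open>0 < d\<close> by (simp add: field_simps)
      then have jr: "real j = of_int \<lfloor>u / d\<rfloor>" unfolding j_def by simp
      have "J \<le> j" using ud unfolding j_def by linarith
      have j: "d * real j \<le> u" "u \<le> d * real j + d"
      proof -
        have "real j \<le> u / d" "u / d \<le> real j + 1" unfolding jr by linarith+
        then show "d * real j \<le> u" "u \<le> d * real j + d" using \<open>0 < d\<close> by (auto simp: field_simps)
      qed
      have "\<omega> \<in> space M" "\<omega> \<notin> cell_overflow d s (a j) j"
        using J(1)[OF \<open>J \<le> j\<close>] J(2) \<open>J \<le> j\<close> by (auto simp: E_def)
      then have start: "\<bar>Z (d * real j) \<omega>\<bar> \<le> a j"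
        and steps: "\<And>m i. i < 2 ^ m \<Longrightarrow> \<bar>Z (d * real j + d * real (Suc i) / 2 ^ m) \<omega> -
          Z (d * real j + d * real i / 2 ^ m) \<omega>\<bar> \<le> s m * (a j + 2 * real (Suc m))"
        unfolding cell_overflow_def by (auto simp: not_less)
      have "\<bar>Z u \<omega> - Z (d * real j) \<omega>\<bar> \<le> (\<Sum>m. s m * (a j + 2 * real (Suc m)))"
      proof (rule dyadic_chaining[where d = d and g = "\<lambda>u. Z u \<omega>"])
        show "continuous_on {d * real j..d * real j + d} (\<lambda>u. Z u \<omega>)"
          by (rule continuous_on_subset[OF cont]) (use \<open>0 < d\<close> in auto)
      qed (use \<open>0 < d\<close> j steps chain_sum in auto)
      then have "\<bar>Z u \<omega>\<bar> \<le> a j * (1 + G0) + G1"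
        using start unfolding chain_sum by (simp add: algebra_simps)
      also have "\<dots> \<le> B0 * sqrt (v (d * real j))"
      proof -
        have "v0 \<le> v (d * real j)"
          unfolding v0_def using J0[of J0] J(3) \<open>J \<le> j\<close> \<open>0 < d\<close> by (intro v_mono) auto
        then have "G1 / sqrt v0 * sqrt v0 \<le> G1 / sqrt v0 * sqrt (v (d * real j))"
          using G \<open>0 < v0\<close> by (intro mult_left_mono) auto
        then have "G1 \<le> G1 / sqrt v0 * sqrt (v (d * real j))" using \<open>0 < v0\<close> by simp
        then show ?thesis by (simp add: B0_def a_def real_sqrt_mult algebra_simps)
      qed
      also have "\<dots> \<le> B0 * sqrt (v u)"
        using J0[of j] J(3) \<open>J \<le> j\<close> j \<open>0 \<le> B0\<close> by (intro mult_left_mono real_sqrt_le_mono v_mono) auto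
      finally have "\<bar>Z u \<omega>\<bar>\<^sup>2 \<le> (B0 * sqrt (v u))\<^sup>2" by (intro power_mono) auto
      moreover have "0 \<le> u" by (rule order_trans[OF _ u]) (use \<open>0 < d\<close> in simp)
      then have "0 \<le> v u" by (rule less_imp_le[OF v_pos])
      ultimately show ?thesis by (simp add: power_mult_distrib)
    qed
    have "compact ((\<lambda>u. (Z u \<omega>)\<^sup>2 / v u) ` {0..d * real J})"
      by (intro compact_continuous_image continuous_intros continuous_on_subset[OF cont]
          continuous_on_subset[OF v_cont]) (use v_pos in force)+
    then have "bdd_above ((\<lambda>u. (Z u \<omega>)\<^sup>2 / v u) ` {0..d * real J})"
      by (intro bounded_imp_bdd_above compact_imp_bounded)
    then obtain B1 where B1: "\<And>u. u \<in> {0..d * real J} \<Longrightarrow> (Z u \<omega>)\<^sup>2 / v u \<le> B1"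
      unfolding bdd_above_def by blast
    have "(Z u \<omega>)\<^sup>2 \<le> max B1 (B0\<^sup>2) * v u" if "0 \<le> u" for u
    proof (cases "d * real J \<le> u")
      case True
      have "B0\<^sup>2 * v u \<le> max B1 (B0\<^sup>2) * v u"
        using v_pos[OF that] by (intro mult_right_mono) auto
      then show ?thesis using far[OF True] by linarith
    next
      case False
      then have "(Z u \<omega>)\<^sup>2 \<le> B1 * v u"
        using B1[of u] v_pos[OF that] that by (simp add: field_simps)
      moreover have "B1 * v u \<le> max B1 (B0\<^sup>2) * v u"
        using v_pos[OF that] by (intro mult_right_mono) auto
      ultimately show ?thesis by linarith
    qed
    then show ?thesis by blast
  qed
  with paths finitely_many show ?thesis by (auto elim!: eventually_elim2)
qed

text \<open>The sum \<open>\<Sum>i<g. exp (l * Z (\<tau> i))\<close> has mean \<open>g * exp (l\<^sup>2 / 2)\<close>. Its relative variance is at most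
  \<open>exp (l\<^sup>2) / g\<close> from the diagonal plus \<open>exp (l\<^sup>2 * \<epsilon>) - 1\<close> from the pairs, and if all summands are too
  small then the sum is at most half its mean, an event controlled by Chebyshev's inequality.\<close>

lemma prob_all_below:
  fixes g :: nat
  assumes "0 < g" and \<tau>: "\<And>i. i < g \<Longrightarrow> 0 \<le> \<tau> i"
    and corr: "\<And>i i'. i < i' \<Longrightarrow> i' < g \<Longrightarrow> \<bar>\<rho> (\<tau> i') (\<tau> i)\<bar> \<le> \<epsilon>"
    and "0 \<le> l" and "0 \<le> \<epsilon>" and R: "exp (l * R) \<le> exp (l\<^sup>2 / 2) / 2"
  shows "prob {\<omega>\<in>space M. \<forall>i<g. Z (\<tau> i) \<omega> \<le> R} \<le> 4 * (exp (l\<^sup>2) / g + (exp (l\<^sup>2 * \<epsilon>) - 1))"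
proof -
  define T where "T \<omega> = (\<Sum>i<g. exp (l * Z (\<tau> i) \<omega>))" for \<omega>
  have Z_rv [measurable]: "random_variable borel (Z (\<tau> i))" if "i < g" for i
    using Z_measurable \<tau> that by simp
  have [measurable]: "random_variable borel T"
    unfolding T_def by (intro borel_measurable_sum) (auto intro: Z_rv)
  have single_int: "integrable M (\<lambda>\<omega>. exp (l * Z (\<tau> i) \<omega>))"
    and single_exp: "expectation (\<lambda>\<omega>. exp (l * Z (\<tau> i) \<omega>)) = exp (l\<^sup>2 / 2)" if "i < g" for i
    using exp_integrable[of "\<tau> i" "\<tau> i" l 0] exp_moment[of "\<tau> i" "\<tau> i" l 0] \<tau>[OF that] by auto
  have T_int: "integrable M T"
    unfolding T_def by (intro Bochner_Integration.integrable_sum) (auto intro: single_int)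
  have T_exp: "expectation T = g * exp (l\<^sup>2 / 2)"
    unfolding T_def by (subst Bochner_Integration.integral_sum) (auto simp: single_int single_exp)
  have T_sq: "(T \<omega>)\<^sup>2 = (\<Sum>i<g. \<Sum>i'<g. exp (l * Z (\<tau> i) \<omega> + l * Z (\<tau> i') \<omega>))" for \<omega>
    unfolding T_def power2_eq_square sum_product by (simp add: exp_add)
  have pair_int: "integrable M (\<lambda>\<omega>. exp (l * Z (\<tau> i) \<omega> + l * Z (\<tau> i') \<omega>))" if "i < g" "i' < g" for i i'
    using that \<tau> by (intro exp_integrable) auto
  have T_sq_int: "integrable M (\<lambda>\<omega>. (T \<omega>)\<^sup>2)"
    unfolding T_sq by (intro Bochner_Integration.integrable_sum) (auto intro: pair_int)
  have pair_exp: "expectation (\<lambda>\<omega>. exp (l * Z (\<tau> i) \<omega> + l * Z (\<tau> i') \<omega>)) \<le>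
      (if i = i' then exp (l\<^sup>2) * exp (l\<^sup>2) else 0) + exp (l\<^sup>2) * exp (l\<^sup>2 * \<epsilon>)" if "i < g" "i' < g" for i i'
  proof -
    have "expectation (\<lambda>\<omega>. exp (l * Z (\<tau> i) \<omega> + l * Z (\<tau> i') \<omega>)) = exp (l\<^sup>2 + l\<^sup>2 * \<rho> (\<tau> i) (\<tau> i'))"
      using that \<tau> by (subst exp_moment) (auto simp: power2_eq_square add_divide_distrib)
    also have "\<dots> \<le> (if i = i' then exp (l\<^sup>2) * exp (l\<^sup>2) else 0) + exp (l\<^sup>2) * exp (l\<^sup>2 * \<epsilon>)"
    proof (cases "i = i'")
      case True
      then show ?thesis using \<rho>_diag \<tau> that by (simp flip: exp_add)
    next
      case False
      then have "\<bar>\<rho> (\<tau> i) (\<tau> i')\<bar> \<le> \<epsilon>"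
        using corr[of i i'] corr[of i' i] \<rho>_sym \<tau> that by (metis linorder_neqE_nat)
      then have "l\<^sup>2 * \<rho> (\<tau> i) (\<tau> i') \<le> l\<^sup>2 * \<epsilon>" by (intro mult_left_mono) auto
      then show ?thesis using False by (simp flip: exp_add)
    qed
    finally show ?thesis .
  qed
  have "expectation (\<lambda>\<omega>. (T \<omega>)\<^sup>2) =
      (\<Sum>i<g. expectation (\<lambda>\<omega>. \<Sum>i'<g. exp (l * Z (\<tau> i) \<omega> + l * Z (\<tau> i') \<omega>)))"
    unfolding T_sq
    by (rule Bochner_Integration.integral_sum) (intro Bochner_Integration.integrable_sum pair_int; simp)
  also have "\<dots> = (\<Sum>i<g. \<Sum>i'<g. expectation (\<lambda>\<omega>. exp (l * Z (\<tau> i) \<omega> + l * Z (\<tau> i') \<omega>)))"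
    by (intro sum.cong refl Bochner_Integration.integral_sum pair_int) auto
  also have "\<dots> \<le> (\<Sum>i<g. \<Sum>i'<g.
      (if i = i' then exp (l\<^sup>2) * exp (l\<^sup>2) else 0) + exp (l\<^sup>2) * exp (l\<^sup>2 * \<epsilon>))"
    by (intro sum_mono pair_exp) auto
  also have "\<dots> = g * (exp (l\<^sup>2) * exp (l\<^sup>2)) + g * (g * (exp (l\<^sup>2) * exp (l\<^sup>2 * \<epsilon>)))"
    by (simp add: sum.distrib distrib_left)
  finally have second: "expectation (\<lambda>\<omega>. (T \<omega>)\<^sup>2) \<le>
      g * (exp (l\<^sup>2) * exp (l\<^sup>2)) + g * (g * (exp (l\<^sup>2) * exp (l\<^sup>2 * \<epsilon>)))" .
  define m where "m = g * exp (l\<^sup>2 / 2)"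
  have "0 < m" using \<open>0 < g\<close> by (simp add: m_def)
  have m_sq: "m\<^sup>2 = g * (g * exp (l\<^sup>2))"
    by (simp add: m_def power_mult_distrib power2_eq_square[of "real g"] mult.assoc flip: exp_double)
  have "prob {\<omega>\<in>space M. \<forall>i<g. Z (\<tau> i) \<omega> \<le> R} \<le> prob {\<omega>\<in>space M. \<bar>T \<omega> - expectation T\<bar> \<ge> m / 2}"
  proof (rule finite_measure_mono)
    show "{\<omega>\<in>space M. \<forall>i<g. Z (\<tau> i) \<omega> \<le> R} \<subseteq> {\<omega>\<in>space M. \<bar>T \<omega> - expectation T\<bar> \<ge> m / 2}"
    proof safe
      fix \<omega> assume below: "\<forall>i<g. Z (\<tau> i) \<omega> \<le> R"
      have "T \<omega> \<le> (\<Sum>i<g. exp (l\<^sup>2 / 2) / 2)"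
        unfolding T_def
      proof (intro sum_mono)
        fix i assume "i \<in> {..<g}"
        then have "exp (l * Z (\<tau> i) \<omega>) \<le> exp (l * R)"
          using below \<open>0 \<le> l\<close> by (auto intro: mult_left_mono)
        then show "exp (l * Z (\<tau> i) \<omega>) \<le> exp (l\<^sup>2 / 2) / 2" using R by linarith
      qed
      then have "T \<omega> \<le> m / 2" by (simp add: m_def)
      then show "\<bar>T \<omega> - expectation T\<bar> \<ge> m / 2" unfolding T_exp m_def[symmetric] by linarith
    qed
  qed measurable
  also have "\<dots> \<le> variance T / (m / 2)\<^sup>2"
    using T_sq_int \<open>0 < m\<close> by (intro Chebyshev_inequality) auto
  also have "variance T = expectation (\<lambda>\<omega>. (T \<omega>)\<^sup>2) - m\<^sup>2"
    using variance_eq[OF T_int T_sq_int] by (simp add: T_exp m_def)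
  also have "(expectation (\<lambda>\<omega>. (T \<omega>)\<^sup>2) - m\<^sup>2) / (m / 2)\<^sup>2 \<le>
      (g * (exp (l\<^sup>2) * exp (l\<^sup>2)) + g * (g * (exp (l\<^sup>2) * exp (l\<^sup>2 * \<epsilon>))) - m\<^sup>2) / (m / 2)\<^sup>2"
    using second by (intro divide_right_mono) auto
  also have "\<dots> = 4 * (exp (l\<^sup>2) / g + (exp (l\<^sup>2 * \<epsilon>) - 1))"
    using \<open>0 < g\<close> unfolding power_divide m_sq by (simp add: field_simps)
  finally show ?thesis .
qed

text \<open>If the paths are dominated by the weight, some fixed \<open>L\<close> works with probability above \<open>1/2\<close>. Among
  the first \<open>g\<^sup>2\<close> grid points pick \<open>g\<close> at mutual distance \<open>g\<close>: they are almost uncorrelated, so their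
  maximum exceeds a multiple of \<open>sqrt (ln g)\<close> with probability above \<open>1/2\<close>. Hence the weight at index \<open>g\<^sup>2\<close>
  is at least a multiple of \<open>ln g\<close>, and a large \<open>c\<close> makes \<open>exp (- c v)\<close> decay like an arbitrary power.\<close>

theorem weight_summable_if_bounded:
  assumes "0 < d" and v_pos: "\<And>u. 0 \<le> u \<Longrightarrow> 0 < v u"
    and v_mono: "\<And>u u'. U \<le> u \<Longrightarrow> u \<le> u' \<Longrightarrow> v u \<le> v u'"
    and corr: "\<And>j l. j0 \<le> j \<Longrightarrow> l0 \<le> l \<Longrightarrow>
      \<bar>\<rho> (d * real (j + l)) (d * real j)\<bar> \<le> m0 * real l powr (- \<beta>)"
    and "0 < m0" "0 < \<beta>"
    and bounded: "AE \<omega> in M. \<exists>B. \<forall>u\<ge>0. (Z u \<omega>)\<^sup>2 \<le> B * v u"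
  shows "\<exists>c>0. summable (\<lambda>j. exp (- c * v (d * real j)))"
proof -
  define A where "A L = {\<omega>\<in>space M. \<forall>j. (Z (d * real j) \<omega>)\<^sup>2 \<le> real L * v (d * real j)}" for L :: nat
  have [measurable]: "random_variable borel (Z (d * real j))" for j
    using \<open>0 < d\<close> by (intro Z_measurable) simp
  have A_sets [measurable]: "A L \<in> sets M" for L unfolding A_def by measurable
  have A_mono: "A L \<subseteq> A L'" if "L \<le> L'" for L L'
  proof -
    have "real L * v (d * real j) \<le> real L' * v (d * real j)" for j
      using that v_pos[of "d * real j"] \<open>0 < d\<close> by (intro mult_right_mono) auto
    then show ?thesis unfolding A_def by (blast intro: order_trans)
  qed
  have "AE \<omega> in M. \<omega> \<in> (\<Union>L. A L)"
    using bounded AE_space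
  proof eventually_elim
    case (elim \<omega>)
    then obtain B where B: "\<And>u. 0 \<le> u \<Longrightarrow> (Z u \<omega>)\<^sup>2 \<le> B * v u" by blast
    obtain L :: nat where "B \<le> real L" using real_arch_simple by blast
    then have "(Z (d * real j) \<omega>)\<^sup>2 \<le> real L * v (d * real j)" for j
      using B[of "d * real j"] v_pos[of "d * real j"] \<open>0 < d\<close>
      by (auto intro: order_trans mult_right_mono)
    then show ?case using elim by (auto simp: A_def)
  qed
  then have "prob (\<Union>L. A L) = 1" by (subst prob_eq_1) auto
  moreover have "(\<lambda>L. prob (A L)) \<longlonglongrightarrow> prob (\<Union>L. A L)"
    using A_mono by (intro finite_Lim_measure_incseq) (auto simp: incseq_def)
  ultimately have "\<forall>\<^sub>F L in sequentially. 1 / 2 < prob (A L)"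
    by (intro order_tendstoD(1)) auto
  then obtain L where L: "1 / 2 < prob (A L)" "1 \<le> L"
    using eventually_conj[OF _ eventually_ge_at_top[of 1]] eventually_happens by fastforce
  define j1 where "j1 = max j0 (nat \<lceil>U / d\<rceil>)"
  have j1: "U \<le> d * real j" if "j1 \<le> j" for j
  proof -
    have "U / d \<le> real j" using that by (simp add: j1_def)
    then show ?thesis using \<open>0 < d\<close> by (simp add: field_simps)
  qed
  have v_le: "v (d * real j) \<le> v (d * real j')" if "j1 \<le> j" "j \<le> j'" for j j'
    using j1[OF that(1)] that(2) \<open>0 < d\<close> by (intro v_mono) auto
  have "(\<lambda>g::nat. 4 * (exp (ln (real g) / 2) / real g +
      (exp (ln (real g) / 2 * (m0 * real g powr (- \<beta>))) - 1))) \<longlonglongrightarrow> 0"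
    using \<open>0 < \<beta>\<close> \<open>0 < m0\<close> by real_asymp
  then have "\<forall>\<^sub>F g in sequentially. 4 * (exp (ln (real g) / 2) / real g +
      (exp (ln (real g) / 2 * (m0 * real g powr (- \<beta>))) - 1)) < 1 / 2"
    by (intro order_tendstoD(2)) auto
  moreover have "\<forall>\<^sub>F g::nat in sequentially. 8 \<le> ln (real g)"
    by real_asymp
  moreover have "\<forall>\<^sub>F g::nat in sequentially. max 1 l0 \<le> g"
    by (rule eventually_ge_at_top)
  ultimately have "\<forall>\<^sub>F g in sequentially. max 1 l0 \<le> g \<and> 8 \<le> ln (real g) \<and>
      4 * (exp (ln (real g) / 2) / real g +
      (exp (ln (real g) / 2 * (m0 * real g powr (- \<beta>))) - 1)) < 1 / 2"
    by eventually_elim auto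
  then obtain g0 where g0: "\<And>g. g0 \<le> g \<Longrightarrow> max 1 l0 \<le> g" "\<And>g. g0 \<le> g \<Longrightarrow> 8 \<le> ln (real g)"
    "\<And>g. g0 \<le> g \<Longrightarrow> 4 * (exp (ln (real g) / 2) / real g +
      (exp (ln (real g) / 2 * (m0 * real g powr (- \<beta>))) - 1)) < 1 / 2"
    unfolding eventually_sequentially by blast
  have growth: "ln (real g) / (32 * real L) \<le> v (d * real (j1 + g\<^sup>2))" if "g0 \<le> g" for g
  proof (rule ccontr)
    assume "\<not> ?thesis"
    then have small: "real L * v (d * real (j1 + g\<^sup>2)) < ln (real g) / 32"
      using L(2) by (simp add: field_simps)
    \<comment> \<open>With this choice \<open>exp (l\<^sup>2) / g = g powr (- 1/2)\<close> vanishes, and so does \<open>l\<^sup>2\<close> times a negative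
      power of \<open>g\<close>, while \<open>l\<close> still grows like \<open>sqrt (ln g)\<close>.\<close>
    define l where "l = sqrt (ln (real g) / 2)"
    have l: "l\<^sup>2 = ln (real g) / 2" "0 \<le> l" using g0(2)[OF that] by (auto simp: l_def)
    have g: "0 < g" "l0 \<le> g" using g0(1)[OF that] by auto
    have spaced: "\<bar>\<rho> (d * real (j1 + i' * g)) (d * real (j1 + i * g))\<bar> \<le> m0 * real g powr (- \<beta>)"
      if "i < i'" "i' < g" for i i'
    proof -
      define k where "k = (i' - i) * g"
      have k: "j1 + i' * g = (j1 + i * g) + k" "g \<le> k"
        using that mult_le_mono1[of "Suc i" i' g] mult_le_mono1[of i i' g]
        by (auto simp: k_def diff_mult_distrib)
      have "\<bar>\<rho> (d * real (j1 + i' * g)) (d * real (j1 + i * g))\<bar> \<le> m0 * real k powr (- \<beta>)"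
        unfolding k(1) using g k(2) by (intro corr[of "j1 + i * g" k]) (auto simp: j1_def)
      also have "\<dots> \<le> m0 * real g powr (- \<beta>)"
        using k(2) g \<open>0 < m0\<close> \<open>0 < \<beta>\<close> by (intro mult_left_mono powr_mono2') auto
      finally show ?thesis .
    qed
    have "2 \<le> exp (1::real)" using exp_ge_add_one_self[of 1] by simp
    also have "\<dots> \<le> exp (l\<^sup>2 / 4)" using g0(2)[OF that] l by simp
    finally have "2 * exp (l * (l / 4)) \<le> exp (l\<^sup>2 / 4) * exp (l * (l / 4))"
      by (intro mult_right_mono) auto
    also have "\<dots> = exp (l\<^sup>2 / 2)" unfolding exp_add[symmetric] by (simp add: power2_eq_square)
    finally have R: "exp (l * (l / 4)) \<le> exp (l\<^sup>2 / 2) / 2" by simp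
    have "A L \<subseteq> {\<omega>\<in>space M. \<forall>i<g. Z (d * real (j1 + i * g)) \<omega> \<le> l / 4}"
    proof safe
      fix \<omega> i assume "\<omega> \<in> A L" "i < g"
      then have "(Z (d * real (j1 + i * g)) \<omega>)\<^sup>2 \<le> real L * v (d * real (j1 + i * g))"
        unfolding A_def by blast
      also have "\<dots> \<le> real L * v (d * real (j1 + g\<^sup>2))"
        using \<open>i < g\<close> by (intro mult_left_mono v_le) (auto simp: power2_eq_square)
      also have "\<dots> \<le> (l / 4)\<^sup>2" using small by (simp add: power_divide l)
      finally show "Z (d * real (j1 + i * g)) \<omega> \<le> l / 4"
        by (rule power2_le_imp_le) (use l in simp)
    qed (auto simp: A_def)
    then have "prob (A L) \<le> prob {\<omega>\<in>space M. \<forall>i<g. Z (d * real (j1 + i * g)) \<omega> \<le> l / 4}"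
    proof (rule finite_measure_mono)
      have [measurable]: "Measurable.pred M (\<lambda>\<omega>. Z (d * real (j1 + i * g)) \<omega> \<le> l / 4)" for i
        by measurable
      show "{\<omega>\<in>space M. \<forall>i<g. Z (d * real (j1 + i * g)) \<omega> \<le> l / 4} \<in> sets M"
        by measurable
    qed
    also have "\<dots> \<le> 4 * (exp (l\<^sup>2) / g + (exp (l\<^sup>2 * (m0 * real g powr (- \<beta>))) - 1))"
      by (rule prob_all_below[where \<tau> = "\<lambda>i. d * real (j1 + i * g)", OF g(1) _ spaced l(2) _ R])
        (use \<open>0 < d\<close> \<open>0 < m0\<close> in auto)
    finally show False using L(1) g0(3)[OF that] by (simp add: l)
  qed
  \<comment> \<open>For \<open>N\<close> between \<open>g\<^sup>2\<close> and \<open>(g + 1)\<^sup>2\<close> this \<open>c\<close> turns the growth bound into \<open>exp (- c v) \<le> g powr (-4)\<close>,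
    which is comparable to \<open>N powr (-2)\<close>.\<close>
  define c where "c = 128 * real L"
  have "summable (\<lambda>N. exp (- c * v (d * real (N + j1))))"
  proof (rule summable_comparison_test'[where N = "g0\<^sup>2"])
    have "summable (\<lambda>N. inverse (real N ^ 2))" by (rule inverse_power_summable) simp
    then have "summable (\<lambda>N. inverse (real (Suc N) ^ 2))" by (subst summable_Suc_iff)
    then show "summable (\<lambda>N. 16 * (1 / real (Suc N) ^ 2))"
      by (intro summable_mult) (simp add: inverse_eq_divide del: of_nat_Suc)
    fix N assume N: "g0\<^sup>2 \<le> N"
    define g where "g = floor_sqrt N"
    have "g0 \<le> g" using N by (simp add: g_def le_floor_sqrt_iff)
    then have "0 < g" using g0(1)[of g] by auto
    have "g\<^sup>2 \<le> N" "N < (Suc g)\<^sup>2"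
      using Suc_floor_sqrt_power2_gt[of N] by (auto simp: g_def)
    have "Suc N \<le> (2 * g)\<^sup>2"
    proof -
      have "Suc N \<le> (Suc g)\<^sup>2" using \<open>N < (Suc g)\<^sup>2\<close> by simp
      also have "\<dots> \<le> (2 * g)\<^sup>2" using \<open>0 < g\<close> by (intro power_mono) auto
      finally show ?thesis .
    qed
    then have "real (Suc N) \<le> (2 * real g)\<^sup>2" 
      using of_nat_mono[of "Suc N" "(2 * g)\<^sup>2", where ?'a = real] by (simp del: of_nat_Suc)
    then have "(real (Suc N))\<^sup>2 \<le> ((2 * real g)\<^sup>2)\<^sup>2" by (intro power_mono) auto
    also have "((2 * real g)\<^sup>2)\<^sup>2 = 16 * real g ^ 4" by (simp add: power2_eq_square power4_eq_xxxx)
    finally have cmp: "(real (Suc N))\<^sup>2 \<le> 16 * real g ^ 4" .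
    have "4 * ln (real g) = c * (ln (real g) / (32 * real L))" using L(2) by (simp add: c_def)
    also have "\<dots> \<le> c * v (d * real (j1 + g\<^sup>2))"
      using growth[OF \<open>g0 \<le> g\<close>] by (intro mult_left_mono) (auto simp: c_def)
    also have "\<dots> \<le> c * v (d * real (N + j1))"
      using \<open>g\<^sup>2 \<le> N\<close> by (intro mult_left_mono v_le) (auto simp: c_def)
    finally have "exp (- c * v (d * real (N + j1))) \<le> exp (- (4 * ln (real g)))" by simp
    also have "\<dots> = 1 / real g ^ 4"
      using \<open>0 < g\<close> exp_of_nat_mult[of 4 "ln (real g)"] by (simp add: exp_minus inverse_eq_divide)
    also have "\<dots> \<le> 16 * (1 / real (Suc N) ^ 2)"
      using cmp \<open>0 < g\<close> by (simp add: field_simps del: of_nat_Suc)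
    finally show "norm (exp (- c * v (d * real (N + j1)))) \<le> 16 * (1 / real (Suc N) ^ 2)" by simp
  qed
  then have "summable (\<lambda>j. exp (- c * v (d * real j)))"
    by (subst (asm) summable_iff_shift)
  moreover have "0 < c" using L(2) by (simp add: c_def)
  ultimately show ?thesis by blast
qed

end

section \<open>The time change at an endpoint of infinite length\<close>

text \<open>Both endpoints are treated at once by working with \<open>\<sigma> * f\<close>, which grows towards \<open>S\<close>. Its inverse
  \<open>\<phi>\<close> maps the half-line onto \<open>half_interval S\<close> and sends \<open>d * j\<close> to the \<open>j\<close>-th partition point.\<close>

locale endpoint_time_change =
  fixes \<alpha> S :: real and C f :: "real \<Rightarrow> real"
  assumes C_cont: "continuous_on {0<..<1} C"
    and C_pos: "\<And>t. t \<in> {0<..<1} \<Longrightarrow> 0 < C t"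
    and S: "S \<in> {0, 1}"
    and f_def: "f = time_change \<alpha> C"
    and f_S: "\<bar>endpoint_value f S\<bar> = \<infinity>"
begin

definition \<psi> :: "real \<Rightarrow> real" where "\<psi> t = C t powr (1 / \<alpha>)"

text \<open>A constant of its own, so that a case distinction does not rewrite \<open>S\<close> inside \<open>\<phi>\<close> and \<open>\<sigma>\<close>.\<close>

definition up :: bool where "up \<longleftrightarrow> S = 1"

definition \<sigma> :: real where "\<sigma> = (if up then 1 else -1)"

definition \<phi> :: "real \<Rightarrow> real" where "\<phi> u = the_inv_into {0<..<1} f (\<sigma> * u)"

lemma dist_S: "t \<in> {0<..<1} \<Longrightarrow> dist S t = (if up then 1 - t else t)"
  using S by (auto simp: up_def dist_real_def)

lemma \<psi>_pos: "t \<in> {0<..<1} \<Longrightarrow> 0 < \<psi> t"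
  using C_pos[of t] by (simp add: \<psi>_def)

lemma \<psi>_cont: "continuous_on {0<..<1} \<psi>"
  unfolding \<psi>_def by (intro continuous_on_powr C_cont continuous_on_const) (auto dest: C_pos)

lemma \<sigma>_cancel [simp]: "\<sigma> * (\<sigma> * x) = x" and \<sigma>_abs: "\<bar>\<sigma> * x\<bar> = \<bar>x\<bar>"
  by (auto simp: \<sigma>_def)

lemma f_deriv:
  assumes t: "t \<in> {0<..<1}"
  shows "(f has_real_derivative \<psi> t) (at t)"
proof -
  define a b where "a = min t (1/2) / 2" and "b = (max t (1/2) + 1) / 2"
  have ab: "0 < a" "a < t" "t < b" "b < 1" "a < 1/2" "1/2 < b"
    using t by (auto simp: a_def b_def)
  have "((\<lambda>u. LBINT y=ereal (1/2)..ereal u. \<psi> y) has_vector_derivative \<psi> t) (at t within {a..b})"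
  proof (rule interval_integral_FTC2)
    show "continuous_on {a..b} \<psi>" by (rule continuous_on_subset[OF \<psi>_cont]) (use ab in auto)
  qed (use ab in auto)
  then have "(f has_vector_derivative \<psi> t) (at t within {a..b})"
    by (simp only: f_def time_change_def[abs_def] \<psi>_def)
  then have "(f has_vector_derivative \<psi> t) (at t within {a<..<b})"
    by (rule has_vector_derivative_within_subset) auto
  moreover have "at t within {a<..<b} = at t" using ab by (intro at_within_open) auto
  ultimately show ?thesis by (simp only: has_real_derivative_iff_has_vector_derivative)
qed

lemma f_cont: "continuous_on {0<..<1} f"
  by (rule DERIV_continuous_on) (rule has_field_derivative_at_within[OF f_deriv])

lemma f_half: "f (1/2) = 0"
  by (simp add: f_def time_change_def)

lemma f_less:
  assumes "0 < s" "s < t" "t < 1"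
  shows "f s < f t"
proof (rule DERIV_pos_imp_increasing[OF assms(2)])
  fix x assume "s \<le> x" "x \<le> t"
  then have "x \<in> {0<..<1}" using assms by auto
  then show "\<exists>y. DERIV f x :> y \<and> 0 < y" using f_deriv \<psi>_pos by blast
qed

lemma f_le_iff:
  assumes "s \<in> {0<..<1}" "t \<in> {0<..<1}"
  shows "f s \<le> f t \<longleftrightarrow> s \<le> t"
  using f_less[of s t] f_less[of t s] assms
  by (metis greaterThanLessThan_iff linorder_not_le order_le_less)

lemma f_inj: "inj_on f {0<..<1}"
proof (rule inj_onI)
  fix s t :: real assume "s \<in> {0<..<1}" "t \<in> {0<..<1}" "f s = f t"
  then show "s = t" using f_le_iff[of s t] f_le_iff[of t s] by simp
qed

lemma half_interval_if: "half_interval S = (if up then {1/2..<1} else {0<..1/2})"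
  unfolding half_interval_def up_def using S by auto

lemma half_interval_iff: "t \<in> half_interval S \<longleftrightarrow> t \<in> {0<..<1} \<and> 0 \<le> \<sigma> * f t"
proof (cases "t \<in> {0<..<1}")
  case True
  then show ?thesis
    using f_le_iff[of t "1/2"] f_le_iff[of "1/2" t] f_half by (auto simp: half_interval_if \<sigma>_def)
qed (auto simp: half_interval_if)

text \<open>The monotone function \<open>\<sigma> * f\<close> has its supremum as limit at \<open>S\<close>; a finite one would contradict the
  infinite endpoint value.\<close>

lemma f_unbounded: "\<exists>t\<in>{0<..<1}. y < \<sigma> * f t"
proof (rule ccontr)
  assume "\<not> ?thesis"
  then have le: "\<sigma> * f t \<le> y" if "t \<in> {0<..<1}" for t using that by (auto simp: not_less)
  define l where "l = (SUP t\<in>{0<..<1}. \<sigma> * f t)"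
  have bdd: "bdd_above ((\<lambda>t. \<sigma> * f t) ` {0<..<1})" using le by (intro bdd_aboveI2)
  have "((\<lambda>t. \<sigma> * f t) \<longlongrightarrow> l) (at S within {0<..<1})"
  proof (rule increasing_tendsto)
    show "\<forall>\<^sub>F t in at S within {0<..<1}. \<sigma> * f t \<le> l"
      unfolding eventually_at_filter l_def using bdd by (auto intro!: always_eventually cSUP_upper)
    fix x assume "x < l"
    then obtain t0 where t0: "t0 \<in> {0<..<1}" "x < \<sigma> * f t0"
      unfolding l_def using bdd by (subst (asm) less_cSUP_iff) auto
    have "\<forall>\<^sub>F t in at S within {0<..<1}. dist t S < dist t0 S"
      using t0 S by (auto simp: eventually_at intro!: exI[of _ "dist t0 S"])
    moreover have "\<forall>\<^sub>F t in at S within {0<..<1}. t \<in> {0<..<1}"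
      by (simp add: eventually_at_filter)
    ultimately show "\<forall>\<^sub>F t in at S within {0<..<1}. x < \<sigma> * f t"
    proof eventually_elim
      case (elim t)
      then have "\<sigma> * f t0 \<le> \<sigma> * f t"
        using t0(1) dist_S[of t] dist_S[of t0] f_le_iff[of t t0] f_le_iff[of t0 t]
        by (auto simp: \<sigma>_def dist_commute split: if_splits)
      then show ?case using t0 by linarith
    qed
  qed
  then have "((\<lambda>t. \<sigma> * (\<sigma> * f t)) \<longlongrightarrow> \<sigma> * l) (at S within {0<..<1})" by (intro tendsto_intros)
  then have "((\<lambda>t. ereal (f t)) \<longlongrightarrow> ereal (\<sigma> * l)) (at S within {0<..<1})" by simp
  moreover have "at S within {0<..<1} \<noteq> bot"
    using S by (auto simp: trivial_limit_within islimpt_greaterThanLessThan1 islimpt_greaterThanLessThan2)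
  ultimately have "endpoint_value f S = ereal (\<sigma> * l)"
    unfolding endpoint_value_def by (intro tendsto_Lim)
  then show False using f_S by simp
qed

lemma f_onto:
  assumes "0 \<le> u" obtains t where "t \<in> {0<..<1}" "\<sigma> * f t = u"
proof -
  obtain t1 where t1: "t1 \<in> {0<..<1}" "u < \<sigma> * f t1" using f_unbounded by blast
  have "connected ((\<lambda>t. \<sigma> * f t) ` {0<..<1})"
    by (intro connected_continuous_image continuous_intros f_cont) simp
  then have "u \<in> (\<lambda>t. \<sigma> * f t) ` {0<..<1}"
  proof (rule connectedD_interval)
    show "\<sigma> * f (1/2) \<in> (\<lambda>t. \<sigma> * f t) ` {0<..<1}" "\<sigma> * f t1 \<in> (\<lambda>t. \<sigma> * f t) ` {0<..<1}"
      using t1(1) by (auto intro: imageI)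
    show "\<sigma> * f (1/2) \<le> u" "u \<le> \<sigma> * f t1" using assms t1(2) by (auto simp: f_half)
  qed
  then show ?thesis using that by blast
qed

lemma
  assumes "0 \<le> u"
  shows \<phi>_in: "\<phi> u \<in> {0<..<1}" and f_\<phi>: "f (\<phi> u) = \<sigma> * u" and \<phi>_half: "\<phi> u \<in> half_interval S"
proof -
  obtain t where t: "t \<in> {0<..<1}" "\<sigma> * f t = u" using f_onto[OF assms] .
  then have "\<sigma> * u = f t" by auto
  then have "\<phi> u = t" unfolding \<phi>_def using t f_inj by (simp add: the_inv_into_f_f)
  then show "\<phi> u \<in> {0<..<1}" "f (\<phi> u) = \<sigma> * u" using t \<open>\<sigma> * u = f t\<close> by auto
  then show "\<phi> u \<in> half_interval S" using assms by (simp add: half_interval_iff)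
qed

lemma \<phi>_f: "t \<in> {0<..<1} \<Longrightarrow> \<phi> (\<sigma> * f t) = t"
  unfolding \<phi>_def using f_inj by (simp add: the_inv_into_f_f)

lemma \<phi>_cont: "continuous_on {0..} \<phi>"
proof (intro continuous_at_imp_continuous_on ballI)
  fix u :: real assume "u \<in> {0..}"
  then have u: "0 \<le> u" by simp
  have "isCont (the_inv_into {0<..<1} f) (f (\<phi> u))"
  proof (rule isCont_inverse_function2[where f = f and x = "\<phi> u" and a = "\<phi> u / 2" and b = "(\<phi> u + 1) / 2"])
    show "\<phi> u / 2 < \<phi> u" "\<phi> u < (\<phi> u + 1) / 2" using \<phi>_in[OF u] by auto
    show "the_inv_into {0<..<1} f (f z) = z" "isCont f z"
      if "\<phi> u / 2 \<le> z" "z \<le> (\<phi> u + 1) / 2" for z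
    proof -
      have "0 < z" "z < 1" using that \<phi>_in[OF u] by auto
      then show "the_inv_into {0<..<1} f (f z) = z" "isCont f z"
        using f_inj f_deriv[of z] by (auto simp: the_inv_into_f_f intro: DERIV_isCont)
    qed
  qed
  then have "isCont (the_inv_into {0<..<1} f) (\<sigma> * u)" by (simp add: f_\<phi>[OF u])
  moreover have "isCont (\<lambda>u. \<sigma> * u) u" by simp
  ultimately have "isCont (\<lambda>u. the_inv_into {0<..<1} f (\<sigma> * u)) u"
    by (rule isCont_o2[rotated])
  then show "isCont \<phi> u" by (simp only: \<phi>_def[abs_def])
qed

lemma \<phi>_towards_S:
  assumes "0 \<le> u" "u \<le> u'"
  shows "if up then \<phi> u \<le> \<phi> u' else \<phi> u' \<le> \<phi> u"
  using assms \<phi>_in[of u] \<phi>_in[of u'] f_\<phi>[of u] f_\<phi>[of u'] f_le_iff[of "\<phi> u" "\<phi> u'"]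
    f_le_iff[of "\<phi> u'" "\<phi> u"] by (auto simp: \<sigma>_def split: if_splits)

lemma partition_point_eq: "partition_point f S d j = \<phi> (d * real j)"
  by (simp add: partition_point_def \<phi>_def \<sigma>_def up_def mult.commute)

lemma partition_interval_eq:
  "partition_interval f S d j = (if up then {\<phi> (d * real (j - 1))..\<phi> (d * real j)}
     else {\<phi> (d * real j)..\<phi> (d * real (j - 1))})"
  unfolding partition_interval_def partition_point_eq up_def by (rule refl)

lemma \<phi>_in_partition_interval:
  assumes "0 < d" "d * real j \<le> u" "u \<le> d * real j + d"
  shows "\<phi> u \<in> partition_interval f S d (Suc j)"
proof -
  have "0 \<le> d * real j" using assms by simp
  moreover from this have "0 \<le> u" using assms by linarith
  ultimately show ?thesis
    using \<phi>_towards_S[of "d * real j" u] \<phi>_towards_S[of u "d * real (Suc j)"] assms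
    by (auto simp: partition_interval_eq algebra_simps split: if_splits)
qed

definition cell :: "real \<Rightarrow> real \<Rightarrow> real set" where
  "cell a b = {t \<in> {0<..<1}. a \<le> \<sigma> * f t \<and> \<sigma> * f t < b}"

lemma cell_sets [measurable]: "cell a b \<in> sets borel"
proof -
  have "(\<lambda>t. indicator {0<..<1} t * (\<sigma> * f t)) \<in> borel_measurable borel"
    using borel_measurable_continuous_on_indicator[of "{0<..<1}" "\<lambda>t. \<sigma> * f t"] f_cont
    by (simp add: continuous_on_mult_left)
  then have "{t. a \<le> indicator {0<..<1} t * (\<sigma> * f t) \<and> indicator {0<..<1} t * (\<sigma> * f t) < b} \<inter> {0<..<1} \<in> sets borel"
    by measurable
  also have "{t. a \<le> indicator {0<..<1} t * (\<sigma> * f t) \<and> indicator {0<..<1} t * (\<sigma> * f t) < b} \<inter> {0<..<1} = cell a b"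
    by (auto simp: cell_def)
  finally show ?thesis .
qed

lemma \<psi>_indicator_measurable [measurable]: "(\<lambda>t. indicator {0<..<1} t * \<psi> t) \<in> borel_measurable borel"
  using borel_measurable_continuous_on_indicator[OF _ \<psi>_cont] by simp

text \<open>Up to an end point, the cell is the interval between \<open>\<phi> a\<close> and \<open>\<phi> b\<close>, on which \<open>\<psi>\<close> has the
  antiderivative \<open>f\<close>.\<close>

lemma nn_integral_cell:
  assumes "0 \<le> a" "a \<le> b"
  shows "(\<integral>\<^sup>+t\<in>cell a b. ennreal (\<psi> t) \<partial>lborel) = ennreal (b - a)"
proof -
  define p q where "p = (if up then \<phi> a else \<phi> b)" and "q = (if up then \<phi> b else \<phi> a)"
  have pq: "p \<in> {0<..<1}" "q \<in> {0<..<1}" "p \<le> q"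
    using \<phi>_in[of a] \<phi>_in[of b] assms \<phi>_towards_S[OF assms] by (auto simp: p_def q_def split: if_splits)
  have f_pq: "f q - f p = b - a"
    using assms by (auto simp: p_def q_def f_\<phi> \<sigma>_def)
  have iff: "a \<le> \<sigma> * f t \<and> \<sigma> * f t \<le> b \<longleftrightarrow> p \<le> t \<and> t \<le> q" if "t \<in> {0<..<1}" for t
    using that pq f_le_iff[of p t] f_le_iff[of t q] f_\<phi>[of a] f_\<phi>[of b] assms
    by (auto simp: p_def q_def \<sigma>_def split: if_splits)
  have "AE t in lborel. t \<noteq> \<phi> b" by (rule AE_lborel_singleton)
  then have "(\<integral>\<^sup>+t\<in>cell a b. ennreal (\<psi> t) \<partial>lborel) =
      (\<integral>\<^sup>+t. ennreal (indicator {0<..<1} t * \<psi> t) * indicator {p..q} t \<partial>lborel)"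
  proof (intro nn_integral_cong_AE, eventually_elim)
    case (elim t)
    have "t \<in> cell a b \<longleftrightarrow> t \<in> {p..q}"
    proof (cases "t \<in> {0<..<1}")
      case True
      then have "\<sigma> * f t \<noteq> b" using elim \<phi>_f[OF True] by auto
      then show ?thesis using iff[OF True] True by (auto simp: cell_def)
    qed (use pq in \<open>auto simp: cell_def\<close>)
    then show ?case using pq by (auto split: split_indicator)
  qed
  also have "\<dots> = ennreal (f q - f p)"
  proof (rule nn_integral_FTC_Icc)
    show "DERIV f t :> indicator {0<..<1} t * \<psi> t" if "t \<in> {p..q}" for t
      using that pq f_deriv[of t] by simp
  qed (use pq \<psi>_pos in \<open>auto intro: less_imp_le split: split_indicator\<close>)
  finally show ?thesis by (simp add: f_pq)
qed

lemma half_interval_eq_cells: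
  assumes "0 < d"
  shows "half_interval S = (\<Union>j. cell (d * real j) (d * real (Suc j)))"
proof (intro set_eqI iffI)
  fix t assume "t \<in> half_interval S"
  then have t: "t \<in> {0<..<1}" "0 \<le> \<sigma> * f t" by (auto simp: half_interval_iff)
  define j where "j = nat \<lfloor>\<sigma> * f t / d\<rfloor>"
  have "real j = of_int \<lfloor>\<sigma> * f t / d\<rfloor>" using t assms by (simp add: j_def)
  then have "real j \<le> \<sigma> * f t / d" "\<sigma> * f t / d < real (Suc j)" by linarith+
  then have "t \<in> cell (d * real j) (d * real (Suc j))"
    using t assms by (simp add: cell_def field_simps)
  then show "t \<in> (\<Union>j. cell (d * real j) (d * real (Suc j)))" by blast
next
  fix t assume "t \<in> (\<Union>j. cell (d * real j) (d * real (Suc j)))"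
  then obtain j where "t \<in> {0<..<1}" "d * real j \<le> \<sigma> * f t" by (auto simp: cell_def)
  moreover have "0 \<le> d * real j" using assms by simp
  ultimately show "t \<in> half_interval S" unfolding half_interval_iff by linarith
qed

lemma cells_disjoint:
  assumes "0 < d"
  shows "disjoint_family (\<lambda>j. cell (d * real j) (d * real (Suc j)))"
  unfolding disjoint_family_on_def
proof (intro ballI impI)
  fix i j :: nat assume "i \<noteq> j"
  have "d * real (Suc i) \<le> d * real j" if "i < j" for i j
    using that assms by (intro mult_left_mono) auto
  from this[of i j] this[of j i] \<open>i \<noteq> j\<close>
  show "cell (d * real i) (d * real (Suc i)) \<inter> cell (d * real j) (d * real (Suc j)) = {}"
    by (cases i j rule: linorder_cases) (force simp: cell_def)+
qed

text \<open>Every cell has mass \<open>d\<close> and the integrand is eventually monotone, so this is the integral test in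
  the time scale \<open>\<sigma> * f\<close>.\<close>

theorem J_integral_finite_iff:
  assumes "0 < d" "0 < c" and w_cont: "continuous_on {0<..<1} w"
    and mono: "\<And>u u'. U \<le> u \<Longrightarrow> u \<le> u' \<Longrightarrow> (w (\<phi> u))\<^sup>2 \<le> (w (\<phi> u'))\<^sup>2"
  shows "J_integral \<alpha> C c w S < \<infinity> \<longleftrightarrow> summable (\<lambda>j. exp (- c * (w (\<phi> (d * real j)))\<^sup>2))"
proof -
  define e where "e t = exp (- c * (w t)\<^sup>2)" for t
  define I where "I j = (\<integral>\<^sup>+t\<in>cell (d * real j) (d * real (Suc j)). ennreal (\<psi> t * e t) \<partial>lborel)" for j
  have [measurable]: "(\<lambda>t. ennreal (\<psi> t * e t) * indicator {0<..<1} t) \<in> borel_measurable borel"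
  proof -
    have "continuous_on {0<..<1} (\<lambda>t. \<psi> t * e t)"
      unfolding e_def by (intro continuous_intros \<psi>_cont w_cont)
    then have "(\<lambda>t. ennreal (indicator {0<..<1} t *\<^sub>R (\<psi> t * e t))) \<in> borel_measurable borel"
      by (intro measurable_compose[OF _ measurable_ennreal] borel_measurable_continuous_on_indicator) auto
    also have "(\<lambda>t. ennreal (indicator {0<..<1} t *\<^sub>R (\<psi> t * e t))) =
        (\<lambda>t. ennreal (\<psi> t * e t) * indicator {0<..<1} t)"
      by (auto split: split_indicator)
    finally show ?thesis .
  qed
  have cell_01: "indicator {0<..<1} t * indicator (cell a b) t = (indicator (cell a b) t :: ennreal)" for t a b
    by (auto simp: cell_def split: split_indicator)
  have "J_integral \<alpha> C c w S = (\<integral>\<^sup>+t\<in>(\<Union>j. cell (d * real j) (d * real (Suc j))).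
      (ennreal (\<psi> t * e t) * indicator {0<..<1} t) \<partial>lborel)"
    unfolding J_integral_def \<psi>_def[symmetric] e_def[symmetric] half_interval_eq_cells[OF \<open>0 < d\<close>]
    by (intro nn_integral_cong) (auto simp: cell_def split: split_indicator)
  also have "\<dots> = (\<Sum>j. I j)"
    using cells_disjoint[OF \<open>0 < d\<close>]
    by (subst nn_integral_disjoint_family) (simp_all add: I_def[abs_def] mult.assoc cell_01 del: of_nat_Suc)
  finally have J: "J_integral \<alpha> C c w S = (\<Sum>j. I j)" .
  have mass: "(\<integral>\<^sup>+t\<in>cell (d * real j) (d * real (Suc j)). ennreal (\<psi> t * x) \<partial>lborel) = ennreal (d * x)"
    if "0 \<le> x" for x j
  proof -
    have "(\<integral>\<^sup>+t\<in>cell (d * real j) (d * real (Suc j)). ennreal (\<psi> t * x) \<partial>lborel) =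
        (\<integral>\<^sup>+t. ennreal x * (ennreal (indicator {0<..<1} t * \<psi> t) * indicator (cell (d * real j) (d * real (Suc j))) t) \<partial>lborel)"
      using \<psi>_pos that
      by (intro nn_integral_cong) (auto simp: cell_def ennreal_mult' mult.commute split: split_indicator)
    also have "\<dots> = ennreal x * (\<integral>\<^sup>+t. ennreal (indicator {0<..<1} t * \<psi> t) * indicator (cell (d * real j) (d * real (Suc j))) t \<partial>lborel)"
      by (rule nn_integral_cmult) measurable
    also have "(\<integral>\<^sup>+t. ennreal (indicator {0<..<1} t * \<psi> t) * indicator (cell (d * real j) (d * real (Suc j))) t \<partial>lborel) =
        (\<integral>\<^sup>+t\<in>cell (d * real j) (d * real (Suc j)). ennreal (\<psi> t) \<partial>lborel)"
      by (intro nn_integral_cong) (auto simp: cell_def split: split_indicator)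
    also have "\<dots> = ennreal d"
      using \<open>0 < d\<close> by (subst nn_integral_cell) (auto simp: algebra_simps)
    finally show ?thesis using that \<open>0 < d\<close> by (simp add: ennreal_mult' mult.commute)
  qed
  define E where "E j = e (\<phi> (d * real j))" for j
  have E: "0 \<le> E j" for j by (simp add: E_def e_def)
  define j0 where "j0 = nat \<lceil>U / d\<rceil>"
  have j0: "U \<le> d * real j" if "j0 \<le> j" for j
  proof -
    have "U / d \<le> real j" using that by (simp add: j0_def)
    then show ?thesis using \<open>0 < d\<close> by (simp add: field_simps)
  qed
  have upper0: "I j \<le> ennreal (d * 1)" for j
  proof -
    have "I j \<le> (\<integral>\<^sup>+t\<in>cell (d * real j) (d * real (Suc j)). ennreal (\<psi> t * 1) \<partial>lborel)"
      unfolding I_def using \<open>0 < c\<close>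
      by (intro nn_integral_mono) (auto simp: e_def cell_def
        intro!: ennreal_leI mult_left_le less_imp_le[OF \<psi>_pos] split: split_indicator)
    then show ?thesis by (simp only: mass[OF zero_le_one])
  qed
  have between: "E (Suc j) \<le> e t" "e t \<le> E j"
    if "j0 \<le> j" "t \<in> cell (d * real j) (d * real (Suc j))" for j t
  proof -
    have t: "t \<in> {0<..<1}" "d * real j \<le> \<sigma> * f t" "\<sigma> * f t \<le> d * real (Suc j)"
      using that by (auto simp: cell_def)
    have "(w (\<phi> (d * real j)))\<^sup>2 \<le> (w (\<phi> (\<sigma> * f t)))\<^sup>2"
      "(w (\<phi> (\<sigma> * f t)))\<^sup>2 \<le> (w (\<phi> (d * real (Suc j))))\<^sup>2"
      using t j0[OF that(1)] by (auto intro!: mono)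
    then show "E (Suc j) \<le> e t" "e t \<le> E j"
      using \<open>0 < c\<close> by (auto simp: E_def e_def \<phi>_f[OF t(1)])
  qed
  have upper: "I j \<le> ennreal (d * E j)" if "j0 \<le> j" for j
  proof -
    have "I j \<le> (\<integral>\<^sup>+t\<in>cell (d * real j) (d * real (Suc j)). ennreal (\<psi> t * E j) \<partial>lborel)"
      unfolding I_def using between(2)[OF that]
      by (intro nn_integral_mono) (auto simp: cell_def simp del: of_nat_Suc
        intro!: ennreal_leI mult_left_mono less_imp_le[OF \<psi>_pos] split: split_indicator)
    then show ?thesis by (simp only: mass[OF E])
  qed
  have lower: "ennreal (d * E (Suc j)) \<le> I j" if "j0 \<le> j" for j
  proof -
    have "(\<integral>\<^sup>+t\<in>cell (d * real j) (d * real (Suc j)). ennreal (\<psi> t * E (Suc j)) \<partial>lborel) \<le> I j"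
      unfolding I_def using between(1)[OF that]
      by (intro nn_integral_mono) (auto simp: cell_def simp del: of_nat_Suc
        intro!: ennreal_leI mult_left_mono less_imp_le[OF \<psi>_pos] split: split_indicator)
    then show ?thesis by (simp only: mass[OF E])
  qed
  have "J_integral \<alpha> C c w S < \<infinity> \<longleftrightarrow> summable E"
  proof
    assume "summable E"
    define B where "B j = (if j < j0 then d else d * E j)" for j
    have "summable (\<lambda>j. d * E j)" by (intro summable_mult \<open>summable E\<close>)
    moreover have "\<forall>\<^sub>F j in sequentially. B j = d * E j"
      using eventually_ge_at_top[of j0] by eventually_elim (simp add: B_def)
    ultimately have "summable B" using summable_cong by fast
    moreover have "0 \<le> B j" for j using E \<open>0 < d\<close> by (simp add: B_def)
    ultimately have "(\<Sum>j. ennreal (B j)) \<noteq> top" by (intro ennreal_suminf_neq_top)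
    moreover have "(\<Sum>j. I j) \<le> (\<Sum>j. ennreal (B j))"
      using upper0 upper by (intro suminf_le) (auto simp: B_def not_less)
    ultimately show "J_integral \<alpha> C c w S < \<infinity>" unfolding J by (auto simp: less_top top_unique)
  next
    assume "J_integral \<alpha> C c w S < \<infinity>"
    define B where "B j = (if j < j0 then 0 else d * E (Suc j))" for j
    have "(\<Sum>j. ennreal (B j)) \<le> (\<Sum>j. I j)"
      using lower by (intro suminf_le) (auto simp: B_def not_less)
    then have "(\<Sum>j. ennreal (B j)) \<noteq> top"
      using \<open>J_integral \<alpha> C c w S < \<infinity>\<close> unfolding J by (auto simp: top_unique)
    moreover have "0 \<le> B j" for j using E \<open>0 < d\<close> by (simp add: B_def)
    ultimately have "summable B" by (intro summable_suminf_not_top)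
    moreover have "\<forall>\<^sub>F j in sequentially. B j = d * E (Suc j)"
      using eventually_ge_at_top[of j0] by eventually_elim (simp add: B_def)
    ultimately have "summable (\<lambda>j. d * E (Suc j))" using summable_cong by fast
    then have "summable (\<lambda>j. (1 / d) * (d * E (Suc j)))" by (rule summable_mult)
    then have "summable (\<lambda>j. E (Suc j))" using \<open>0 < d\<close> by simp
    then show "summable E" by (simp add: summable_Suc_iff)
  qed
  then show ?thesis by (simp add: E_def[abs_def] e_def)
qed

lemma weight_eventually_mono:
  assumes "condition_A w S"
  obtains U where "\<And>u u'. U \<le> u \<Longrightarrow> u \<le> u' \<Longrightarrow> (w (\<phi> u))\<^sup>2 \<le> (w (\<phi> u'))\<^sup>2"
proof -
  obtain \<delta> where \<delta>: "0 < \<delta>"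
    "mono_on ({0<..<1} \<inter> ball S \<delta>) (\<lambda>t. (w t)\<^sup>2) \<or> antimono_on ({0<..<1} \<inter> ball S \<delta>) (\<lambda>t. (w t)\<^sup>2)"
    and lim: "filterlim (\<lambda>t. (w t)\<^sup>2) at_top (at S within {0<..<1})"
    using assms unfolding condition_A_def by blast
  have nontriv: "at S within {0<..<1} \<noteq> bot"
    using S by (auto simp: trivial_limit_within islimpt_greaterThanLessThan1 islimpt_greaterThanLessThan2)
  \<comment> \<open>As the weight tends to infinity at \<open>S\<close>, it cannot decrease towards \<open>S\<close>.\<close>
  have closer: "(w s)\<^sup>2 \<le> (w t)\<^sup>2"
    if st: "s \<in> {0<..<1}" "t \<in> {0<..<1}" "dist S t \<le> dist S s" "dist S s < \<delta>" for s t
  proof (rule ccontr)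
    assume "\<not> ?thesis"
    then have less: "(w t)\<^sup>2 < (w s)\<^sup>2" by simp
    have nb: "s \<in> {0<..<1} \<inter> ball S \<delta>" "t \<in> {0<..<1} \<inter> ball S \<delta>" using st by auto
    have "\<forall>\<^sub>F x in at S within {0<..<1}. (w s)\<^sup>2 < (w x)\<^sup>2"
      using lim by (simp add: filterlim_at_top_dense)
    moreover have "\<forall>\<^sub>F x in at S within {0<..<1}. dist x S < dist t S"
      using st S by (auto simp: eventually_at intro!: exI[of _ "dist t S"])
    moreover have "\<forall>\<^sub>F x in at S within {0<..<1}. x \<in> {0<..<1}"
      by (simp add: eventually_at_filter)
    ultimately have "\<forall>\<^sub>F x in at S within {0<..<1}. (w s)\<^sup>2 < (w x)\<^sup>2 \<and> dist x S < dist t S \<and> x \<in> {0<..<1}"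
      by eventually_elim auto
    then obtain x where x: "(w s)\<^sup>2 < (w x)\<^sup>2" "dist x S < dist t S" "x \<in> {0<..<1}"
      using eventually_happens nontriv by blast
    then have xt: "dist S x < dist S t" by (simp add: dist_commute)
    then have xb: "x \<in> {0<..<1} \<inter> ball S \<delta>" using st x by auto
    have "(s \<le> t \<and> t \<le> x) \<or> (x \<le> t \<and> t \<le> s)"
      using xt st x(3) by (simp add: dist_S split: if_splits)
    with \<delta>(2) nb xb have "(w s)\<^sup>2 \<le> (w t)\<^sup>2 \<or> (w x)\<^sup>2 \<le> (w t)\<^sup>2"
      unfolding monotone_on_def by blast
    with less x(1) show False by linarith
  qed
  define t0 where "t0 = (if up then max (1/2) (1 - \<delta> / 2) else min (1/2) (\<delta> / 2))"
  have t0: "t0 \<in> {0<..<1}" "dist S t0 < \<delta>"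
    using \<delta>(1) dist_S[of t0] by (auto simp: t0_def min_def max_def split: if_splits)
  define U where "U = \<sigma> * f t0"
  have "t0 \<in> half_interval S"
    using t0(1) by (auto simp: half_interval_if t0_def)
  then have "0 \<le> U" by (simp add: U_def half_interval_iff)
  have near: "dist S (\<phi> u) < \<delta>" if "U \<le> u" for u
  proof -
    have "\<phi> U = t0" unfolding U_def by (rule \<phi>_f[OF t0(1)])
    then have "dist S (\<phi> u) \<le> dist S t0"
      using \<phi>_towards_S[OF \<open>0 \<le> U\<close> that] \<phi>_in[of u] that \<open>0 \<le> U\<close> t0(1)
      by (simp add: dist_S split: if_splits)
    then show ?thesis using t0(2) by simp
  qed
  show ?thesis
  proof (rule that[of U])
    show "(w (\<phi> u))\<^sup>2 \<le> (w (\<phi> u'))\<^sup>2" if "U \<le> u" "u \<le> u'" for u u'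
      using that near[of u] \<phi>_in[of u] \<phi>_in[of u'] \<phi>_towards_S[of u u'] \<open>0 \<le> U\<close>
      by (intro closer) (auto simp: dist_S split: if_splits)
  qed
qed

end

section \<open>Exponential moments of the copies\<close>

lemma gaussian_process_combination:
  "gaussian_process M T X \<Longrightarrow> finite F \<Longrightarrow> F \<subseteq> T \<Longrightarrow> gaussian_rv M (\<lambda>\<omega>. \<Sum>t\<in>F. c t * X t \<omega>)"
  by (simp add: gaussian_process_def)

lemma (in prob_space) gaussian_pair_exp_moment:
  assumes gauss: "gaussian_process M T X"
    and centered: "\<And>t. t \<in> T \<Longrightarrow> expectation (X t) = 0"
    and var: "\<And>t. t \<in> T \<Longrightarrow> variance (X t) = 1"
    and st: "s \<in> T" "t \<in> T"
  shows "integrable M (\<lambda>\<omega>. exp (p * X s \<omega> + q * X t \<omega>))"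
    and "expectation (\<lambda>\<omega>. exp (p * X s \<omega> + q * X t \<omega>)) =
      exp ((p\<^sup>2 + q\<^sup>2 + 2 * p * q * correlation M (X s) (X t)) / 2)"
    and "correlation M (X s) (X s) = 1"
proof -
  have rv: "gaussian_rv M (\<lambda>\<omega>. p * X s \<omega> + q * X t \<omega>)" for p q
  proof (cases "s = t")
    case True
    have "gaussian_rv M (\<lambda>\<omega>. \<Sum>x\<in>{s}. (p + q) * X x \<omega>)"
      by (rule gaussian_process_combination[OF gauss]) (use st in auto)
    then show ?thesis using True by (simp add: algebra_simps)
  next
    case False
    have "gaussian_rv M (\<lambda>\<omega>. \<Sum>x\<in>{s, t}. (if x = s then p else q) * X x \<omega>)"
      by (rule gaussian_process_combination[OF gauss]) (use st in auto)
    then show ?thesis using False by auto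
  qed
  have sq_int: "integrable M (\<lambda>\<omega>. (p * X s \<omega> + q * X t \<omega>)\<^sup>2)" for p q
    by (rule gaussian_rv_integrable_square[OF rv])
  have meas [measurable]: "random_variable borel (X s)" "random_variable borel (X t)"
    using rv[of 1 0] rv[of 0 1] by (auto simp: gaussian_rv_def)
  have int_sq: "integrable M (\<lambda>\<omega>. (X s \<omega>)\<^sup>2)" "integrable M (\<lambda>\<omega>. (X t \<omega>)\<^sup>2)"
    using sq_int[of 1 0] sq_int[of 0 1] by auto
  have int: "integrable M (X s)" "integrable M (X t)"
    using int_sq by (auto intro: square_integrable_imp_integrable)
  have "integrable M (\<lambda>\<omega>. ((1 * X s \<omega> + 1 * X t \<omega>)\<^sup>2 - (X s \<omega>)\<^sup>2 - (X t \<omega>)\<^sup>2) / 2)"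
    by (intro Bochner_Integration.integrable_diff integrable_divide sq_int int_sq)
  also have "(\<lambda>\<omega>. ((1 * X s \<omega> + 1 * X t \<omega>)\<^sup>2 - (X s \<omega>)\<^sup>2 - (X t \<omega>)\<^sup>2) / 2) = (\<lambda>\<omega>. X s \<omega> * X t \<omega>)"
    by (auto simp: power2_eq_square algebra_simps)
  finally have int_prod: "integrable M (\<lambda>\<omega>. X s \<omega> * X t \<omega>)" .
  have corr: "correlation M (X s) (X t) = expectation (\<lambda>\<omega>. X s \<omega> * X t \<omega>)"
    using centered[OF st(1)] centered[OF st(2)] var[OF st(1)] var[OF st(2)]
    by (simp add: correlation_def)
  have second: "expectation (\<lambda>\<omega>. (X s \<omega>)\<^sup>2) = 1" "expectation (\<lambda>\<omega>. (X t \<omega>)\<^sup>2) = 1"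
    using var[OF st(1)] var[OF st(2)] centered[OF st(1)] centered[OF st(2)] by auto
  show "correlation M (X s) (X s) = 1"
    using centered[OF st(1)] var[OF st(1)] by (simp add: correlation_def power2_eq_square)
  have mean: "expectation (\<lambda>\<omega>. p * X s \<omega> + q * X t \<omega>) = 0"
    using int centered st by simp
  have "(p * X s \<omega> + q * X t \<omega>)\<^sup>2 =
      p\<^sup>2 * (X s \<omega>)\<^sup>2 + q\<^sup>2 * (X t \<omega>)\<^sup>2 + 2 * p * q * (X s \<omega> * X t \<omega>)" for \<omega>
    by (simp add: power2_eq_square algebra_simps)
  then have "expectation (\<lambda>\<omega>. (p * X s \<omega> + q * X t \<omega>)\<^sup>2) =
      p\<^sup>2 + q\<^sup>2 + 2 * p * q * correlation M (X s) (X t)"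
    using int_sq int_prod second by (simp add: corr)
  then show "integrable M (\<lambda>\<omega>. exp (p * X s \<omega> + q * X t \<omega>))"
    "expectation (\<lambda>\<omega>. exp (p * X s \<omega> + q * X t \<omega>)) =
      exp ((p\<^sup>2 + q\<^sup>2 + 2 * p * q * correlation M (X s) (X t)) / 2)"
    using gaussian_rv_exp_moment[OF rv mean] by simp_all
qed

lemma process_copy_pair_moments:
  fixes g :: "real \<Rightarrow> real \<Rightarrow> real"
  assumes copy: "process_copy M N T Y X" and X: "\<And>t. t \<in> T \<Longrightarrow> X t \<in> borel_measurable N"
    and st: "s \<in> T" "t \<in> T" and g: "case_prod g \<in> borel_measurable (borel \<Otimes>\<^sub>M borel)"
  shows "integrable M (\<lambda>\<omega>. g (Y s \<omega>) (Y t \<omega>)) \<longleftrightarrow> integrable N (\<lambda>\<omega>. g (X s \<omega>) (X t \<omega>))"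
    and "integral\<^sup>L M (\<lambda>\<omega>. g (Y s \<omega>) (Y t \<omega>)) = integral\<^sup>L N (\<lambda>\<omega>. g (X s \<omega>) (X t \<omega>))"
proof -
  let ?P = "PiM T (\<lambda>_. borel :: real measure)"
  have Ym: "(\<lambda>\<omega>. \<lambda>t\<in>T. Y t \<omega>) \<in> measurable M ?P"
    using copy by (intro measurable_restrict) (auto simp: process_copy_def)
  have Xm: "(\<lambda>\<omega>. \<lambda>t\<in>T. X t \<omega>) \<in> measurable N ?P"
    using X by (intro measurable_restrict)
  have eq: "distr M ?P (\<lambda>\<omega>. \<lambda>t\<in>T. Y t \<omega>) = distr N ?P (\<lambda>\<omega>. \<lambda>t\<in>T. X t \<omega>)"
    using copy by (simp add: process_copy_def)
  have "(\<lambda>x. (x s, x t)) \<in> measurable ?P (borel \<Otimes>\<^sub>M borel)"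
    using st by (intro measurable_Pair measurable_component_singleton)
  from measurable_compose[OF this g] have G: "(\<lambda>x. g (x s) (x t)) \<in> borel_measurable ?P"
    by simp
  show "integrable M (\<lambda>\<omega>. g (Y s \<omega>) (Y t \<omega>)) \<longleftrightarrow> integrable N (\<lambda>\<omega>. g (X s \<omega>) (X t \<omega>))"
    using integrable_distr_eq[OF Ym G] integrable_distr_eq[OF Xm G] eq st by simp
  show "integral\<^sup>L M (\<lambda>\<omega>. g (Y s \<omega>) (Y t \<omega>)) = integral\<^sup>L N (\<lambda>\<omega>. g (X s \<omega>) (X t \<omega>))"
    using integral_distr[OF Ym G] integral_distr[OF Xm G] eq st by simp
qed

text \<open>A copy has the same law on the product space, hence the same exponential moments of pairs.\<close>

lemma half_line_gaussian_copy:
  assumes prob: "prob_space M" "prob_space N"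
    and gauss: "gaussian_process N T X"
    and centered: "\<And>t. t \<in> T \<Longrightarrow> prob_space.expectation N (X t) = 0"
    and var: "\<And>t. t \<in> T \<Longrightarrow> prob_space.variance N (X t) = 1"
    and r: "\<And>s t. s \<in> T \<Longrightarrow> t \<in> T \<Longrightarrow> r s t = correlation N (X s) (X t)"
    and copy: "process_copy M N T Y X"
    and \<phi>: "\<And>u. 0 \<le> u \<Longrightarrow> \<phi> u \<in> T"
  shows "half_line_gaussian M (\<lambda>u. Y (\<phi> u)) (\<lambda>u u'. r (\<phi> u) (\<phi> u'))"
proof -
  interpret N: prob_space N by (rule prob(2))
  interpret M: prob_space M by (rule prob(1))
  have X_rv: "X t \<in> borel_measurable N" if "t \<in> T" for t
  proof -
    have "gaussian_rv N (\<lambda>\<omega>. \<Sum>x\<in>{t}. 1 * X x \<omega>)"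
      by (rule gaussian_process_combination[OF gauss]) (use that in auto)
    then show ?thesis by (simp add: gaussian_rv_def)
  qed
  have moments: "integrable N (\<lambda>\<omega>. exp (p * X s \<omega> + q * X t \<omega>))"
    "N.expectation (\<lambda>\<omega>. exp (p * X s \<omega> + q * X t \<omega>)) = exp ((p\<^sup>2 + q\<^sup>2 + 2 * p * q * r s t) / 2)"
    "r s s = 1" if "s \<in> T" "t \<in> T" for s t p q
    using N.gaussian_pair_exp_moment(1,2)[where X = X and T = T and s = s and t = t and p = p and q = q]
      N.gaussian_pair_exp_moment(3)[where X = X and T = T and s = s and t = t]
      gauss centered var that r by simp_all
  have exp_meas: "(\<lambda>(x, y). exp (p * x + q * y)) \<in> borel_measurable (borel \<Otimes>\<^sub>M borel)" for p q :: real
    by measurable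
  have transfer: "integrable M (\<lambda>\<omega>. exp (p * Y s \<omega> + q * Y t \<omega>)) \<longleftrightarrow>
      integrable N (\<lambda>\<omega>. exp (p * X s \<omega> + q * X t \<omega>))"
    "M.expectation (\<lambda>\<omega>. exp (p * Y s \<omega> + q * Y t \<omega>)) = N.expectation (\<lambda>\<omega>. exp (p * X s \<omega> + q * X t \<omega>))"
    if "s \<in> T" "t \<in> T" for s t p q
    by (rule process_copy_pair_moments[OF copy X_rv that exp_meas], assumption)+
  show ?thesis
  proof unfold_locales
    fix u u' p q :: real assume u: "0 \<le> u" "0 \<le> u'"
    show "Y (\<phi> u) \<in> borel_measurable M"
      using copy \<phi>[OF u(1)] by (simp add: process_copy_def)
    show "r (\<phi> u) (\<phi> u) = 1"
      using moments(3)[OF \<phi>[OF u(1)] \<phi>[OF u(1)]] .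
    show "r (\<phi> u) (\<phi> u') = r (\<phi> u') (\<phi> u)"
      using r \<phi>[OF u(1)] \<phi>[OF u(2)] by (simp add: correlation_def mult.commute)
    show "integrable M (\<lambda>\<omega>. exp (p * Y (\<phi> u) \<omega> + q * Y (\<phi> u') \<omega>))"
      using transfer(1)[OF \<phi>[OF u(1)] \<phi>[OF u(2)]] moments(1)[OF \<phi>[OF u(1)] \<phi>[OF u(2)]] by simp
    show "M.expectation (\<lambda>\<omega>. exp (p * Y (\<phi> u) \<omega> + q * Y (\<phi> u') \<omega>)) =
        exp ((p\<^sup>2 + q\<^sup>2 + 2 * p * q * r (\<phi> u) (\<phi> u')) / 2)"
      using transfer(2)[OF \<phi>[OF u(1)] \<phi>[OF u(2)]] moments(2)[OF \<phi>[OF u(1)] \<phi>[OF u(2)]] by simp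
  qed
qed

section \<open>The integral criterion\<close>

context endpoint_time_change
begin

text \<open>The two ends of a dyadic step of level \<open>m\<close> are \<open>d / 2 ^ m\<close> apart in the time scale of \<open>f\<close>, so
  condition B bounds \<open>1 - r\<close> by a multiple of \<open>(K (d / 2 ^ m))\<^sup>2\<close>, which decays geometrically in \<open>m\<close>.\<close>

lemma condition_B_dyadic:
  assumes B: "condition_B \<alpha> k K f r S"
    and rv: "regularly_varying_at_0 (\<alpha> / 2) K" and K_pos: "\<And>t. 0 < t \<Longrightarrow> 0 < K t" and "0 < \<alpha>"
  obtains d D \<theta> j1 where "0 < d" "0 < D" "0 < \<theta>" "\<theta> < 1"
    "\<And>j m i. j1 \<le> j \<Longrightarrow> i < 2 ^ m \<Longrightarrow>
      2 * (1 - r (\<phi> (d * real j + d * real (Suc i) / 2 ^ m)) (\<phi> (d * real j + d * real i / 2 ^ m)))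
        \<le> (D * \<theta> ^ m)\<^sup>2"
proof -
  obtain d where d: "0 < d" and limsup: "limsup (\<lambda>j. SUP (t, s)\<in>distinct_pairs (partition_interval f S d j).
      ereal ((1 - r t s) / (K \<bar>f t - f s\<bar>)\<^sup>2)) < \<infinity>"
    using B unfolding condition_B_def by blast
  obtain b where b: "limsup (\<lambda>j. SUP (t, s)\<in>distinct_pairs (partition_interval f S d j).
      ereal ((1 - r t s) / (K \<bar>f t - f s\<bar>)\<^sup>2)) < ereal b"
    using ereal_dense2[OF limsup] by auto
  define B where "B = max b 1"
  have "\<forall>\<^sub>F j in sequentially. (SUP (t, s)\<in>distinct_pairs (partition_interval f S d j).
      ereal ((1 - r t s) / (K \<bar>f t - f s\<bar>)\<^sup>2)) < ereal b"
    using b by (rule Limsup_lessD)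
  then obtain j1 where j1: "\<And>j. j1 \<le> j \<Longrightarrow> (SUP (t, s)\<in>distinct_pairs (partition_interval f S d j).
      ereal ((1 - r t s) / (K \<bar>f t - f s\<bar>)\<^sup>2)) < ereal b"
    by (auto simp: eventually_sequentially)
  obtain D \<theta> where D: "0 < D" "0 < \<theta>" "\<theta> < 1" "\<And>m::nat. K (d / 2 ^ m) \<le> D * \<theta> ^ m"
    using regularly_varying_dyadic_decay[OF rv K_pos _ d] \<open>0 < \<alpha>\<close> by auto
  show ?thesis
  proof (rule that[of d "sqrt (2 * B) * D" \<theta> j1])
    show "0 < d" "0 < sqrt (2 * B) * D" "0 < \<theta>" "\<theta> < 1" using d D by (auto simp: B_def)
    fix j m i :: nat assume j: "j1 \<le> j" and i: "i < 2 ^ m"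
    define u u' where "u = d * real j + d * real (Suc i) / 2 ^ m" and "u' = d * real j + d * real i / 2 ^ m"
    have "real (Suc i) / 2 ^ m \<le> 1" "real i / 2 ^ m \<le> 1"
    proof -
      have "real (Suc i) \<le> real (2 ^ m)" "real i \<le> real (2 ^ m)"
        using i by (simp_all only: of_nat_le_iff Suc_le_eq less_imp_le)
      then show "real (Suc i) / 2 ^ m \<le> 1" "real i / 2 ^ m \<le> 1" by auto
    qed
    then have "d * (real (Suc i) / 2 ^ m) \<le> d * 1" "d * (real i / 2 ^ m) \<le> d * 1"
      using d by (intro mult_left_mono; simp)+
    then have le: "u \<le> d * real j + d" "u' \<le> d * real j + d" by (auto simp: u_def u'_def)
    have ge: "d * real j \<le> u" "d * real j \<le> u'" using d by (auto simp: u_def u'_def)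
    have "0 \<le> d * real j" using d by simp
    then have nonneg: "0 \<le> u" "0 \<le> u'" using ge by linarith+
    have diff: "u - u' = d / 2 ^ m" by (simp add: u_def u'_def field_simps)
    have "f (\<phi> u) - f (\<phi> u') = \<sigma> * (u - u')" using nonneg by (simp add: f_\<phi> right_diff_distrib)
    then have f_diff: "\<bar>f (\<phi> u) - f (\<phi> u')\<bar> = d / 2 ^ m" using d by (simp add: \<sigma>_abs diff)
    have "\<phi> u \<noteq> \<phi> u'"
    proof
      assume "\<phi> u = \<phi> u'"
      then show False using f_diff d by simp
    qed
    then have pair: "(\<phi> u, \<phi> u') \<in> distinct_pairs (partition_interval f S d (Suc j))"
      using \<phi>_in_partition_interval[OF d] ge le by (simp add: distinct_pairs_def)
    have "ereal ((1 - r (\<phi> u) (\<phi> u')) / (K \<bar>f (\<phi> u) - f (\<phi> u')\<bar>)\<^sup>2) \<le>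
        (SUP (t, s)\<in>distinct_pairs (partition_interval f S d (Suc j)). ereal ((1 - r t s) / (K \<bar>f t - f s\<bar>)\<^sup>2))"
      using SUP_upper[OF pair, of "\<lambda>(t, s). ereal ((1 - r t s) / (K \<bar>f t - f s\<bar>)\<^sup>2)"] by simp
    also have "\<dots> < ereal b" using j by (intro j1) simp
    finally have "(1 - r (\<phi> u) (\<phi> u')) / (K (d / 2 ^ m))\<^sup>2 < b" by (simp add: f_diff)
    moreover have K: "0 < K (d / 2 ^ m)" using d by (intro K_pos) simp
    ultimately have "1 - r (\<phi> u) (\<phi> u') \<le> b * (K (d / 2 ^ m))\<^sup>2" by (simp add: field_simps)
    also have "\<dots> \<le> B * (K (d / 2 ^ m))\<^sup>2" by (intro mult_right_mono) (auto simp: B_def)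
    also have "\<dots> \<le> B * (D * \<theta> ^ m)\<^sup>2"
      using D(4)[of m] K by (intro mult_left_mono power_mono) (auto simp: B_def)
    finally have "2 * (1 - r (\<phi> u) (\<phi> u')) \<le> (2 * B) * (D * \<theta> ^ m)\<^sup>2" by simp
    also have "\<dots> = (sqrt (2 * B) * D * \<theta> ^ m)\<^sup>2" by (simp add: power_mult_distrib B_def)
    finally show "2 * (1 - r (\<phi> (d * real j + d * real (Suc i) / 2 ^ m))
        (\<phi> (d * real j + d * real i / 2 ^ m))) \<le> (sqrt (2 * B) * D * \<theta> ^ m)\<^sup>2"
      by (simp only: u_def u'_def)
  qed
qed

lemma condition_C_grid:
  assumes "condition_C K f r S"
  shows "\<exists>d>0. \<exists>m0>0. \<exists>\<beta>>0. \<exists>j0 l0. \<forall>j\<ge>j0. \<forall>l\<ge>l0.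
    \<bar>r (\<phi> (d * real (j + l))) (\<phi> (d * real j))\<bar> \<le> m0 * real l powr (- \<beta>)"
proof -
  obtain d j0 l0 m0 \<beta> where d: "0 < d" and j0: "(1::nat) \<le> j0" and "0 < m0" "0 < \<beta>"
    and sup: "\<And>j l. j0 \<le> j \<Longrightarrow> (l0::nat) \<le> l \<Longrightarrow>
      (SUP (s, t)\<in>partition_interval f S d (j + l) \<times> partition_interval f S d j. ereal \<bar>r s t\<bar>)
        < ereal (m0 * real l powr (- \<beta>))"
    using assms unfolding condition_C_def by blast
  \<comment> \<open>The grid point \<open>d * j\<close> belongs to the \<open>j\<close>-th partition interval as its end point nearest to \<open>S\<close>.\<close>
  have right_end: "\<phi> (d * real j) \<in> partition_interval f S d j" if "1 \<le> j" for j
    using \<phi>_in_partition_interval[OF d, of "j - 1" "d * real j"] that d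
    by (simp add: of_nat_diff right_diff_distrib)
  have "\<bar>r (\<phi> (d * real (j + l))) (\<phi> (d * real j))\<bar> \<le> m0 * real l powr (- \<beta>)"
    if jl: "j0 \<le> j" "l0 \<le> l" for j l
  proof -
    have "(\<phi> (d * real (j + l)), \<phi> (d * real j)) \<in>
        partition_interval f S d (j + l) \<times> partition_interval f S d j"
      using right_end[of "j + l"] right_end[of j] j0 jl by simp
    from SUP_upper[OF this, of "\<lambda>(s, t). ereal \<bar>r s t\<bar>"]
    have "ereal \<bar>r (\<phi> (d * real (j + l))) (\<phi> (d * real j))\<bar> \<le>
        (SUP (s, t)\<in>partition_interval f S d (j + l) \<times> partition_interval f S d j. ereal \<bar>r s t\<bar>)"
      by simp
    also have "\<dots> < ereal (m0 * real l powr (- \<beta>))" by (rule sup[OF jl])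
    finally show ?thesis by simp
  qed
  then show ?thesis using d \<open>0 < m0\<close> \<open>0 < \<beta>\<close> by (intro exI conjI allI impI)
qed

end

theorem theorem3p1:
  fixes M :: "'a measure" and N :: "'b measure"
    and X :: "real \<Rightarrow> 'b \<Rightarrow> real" and Y :: "nat \<Rightarrow> real \<Rightarrow> 'a \<Rightarrow> real"
    and n k :: nat and b :: "nat \<Rightarrow> real"
    and \<alpha> S :: real and K C w f :: "real \<Rightarrow> real" and r :: "real \<Rightarrow> real \<Rightarrow> real"
  assumes prob: "prob_space M" "prob_space N"
    and nk: "1 \<le> k" "k \<le> n"
    and b_one: "\<And>i. 1 \<le> i \<Longrightarrow> i \<le> k \<Longrightarrow> b i = 1"
    and b_less: "k < n \<Longrightarrow> b (k + 1) < 1"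
    and b_decr: "\<And>i j. k + 1 \<le> i \<Longrightarrow> i \<le> j \<Longrightarrow> j \<le> n \<Longrightarrow> b j \<le> b i"
    and b_pos: "\<And>i. 1 \<le> i \<Longrightarrow> i \<le> n \<Longrightarrow> 0 < b i"
    and alpha: "0 < \<alpha>" "\<alpha> \<le> 2"
    and K_pos: "\<And>t. 0 < t \<Longrightarrow> 0 < K t"
    and K_rv: "regularly_varying_at_0 (\<alpha> / 2) K"
    and K_inv: "inverse_exists_asymptotically K"
    and C_cont: "continuous_on {0<..<1} C"
    and C_pos: "\<And>t. t \<in> {0<..<1} \<Longrightarrow> 0 < C t"
    and C_lim: "filterlim C at_top (at_right 0) \<or> filterlim C at_top (at_left 1)"
    and w_cont: "continuous_on {0<..<1} w"
    and w_pos: "\<And>t. t \<in> {0<..<1} \<Longrightarrow> 0 < w t"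
    and X_gauss: "gaussian_process N {0<..<1} X"
    and X_cont: "as_continuous_paths N {0<..<1} X"
    and X_centered: "\<And>t. t \<in> {0<..<1} \<Longrightarrow> prob_space.expectation N (X t) = 0"
    and X_var: "\<And>t. t \<in> {0<..<1} \<Longrightarrow> prob_space.variance N (X t) = 1"
    and r_def: "\<And>s t. s \<in> {0<..<1} \<Longrightarrow> t \<in> {0<..<1} \<Longrightarrow> r s t = correlation N (X s) (X t)"
    and loc_stat: "\<And>a a'. 0 < a \<Longrightarrow> a \<le> a' \<Longrightarrow> a' < 1 \<Longrightarrow>
          uniform_limit {a..a'} (\<lambda>h t. (1 - r t (t + h)) / (K \<bar>h\<bar>)\<^sup>2) C (at 0)"
    and r_less: "\<And>s t. s \<in> {0<..<1} \<Longrightarrow> t \<in> {0<..<1} \<Longrightarrow> s \<noteq> t \<Longrightarrow> r s t < 1"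
    and copies: "independent_copies M N {0<..<1} {1..n} Y X"
    and S: "S \<in> {0, 1}"
    and f_def: "f = time_change \<alpha> C"
    and f_S: "\<bar>endpoint_value f S\<bar> = \<infinity>"
    and A: "condition_A w S"
    and B: "condition_B \<alpha> k K f r S"
    and C: "condition_C K f r S"
  shows "(AE \<omega> in M. (SUP t\<in>half_interval S. ereal (chi_sq n b Y t \<omega> / (w t)\<^sup>2)) < \<infinity>)
         \<longleftrightarrow> (\<exists>c>0. J_integral \<alpha> C c w S < \<infinity>)"
proof -
  interpret tc: endpoint_time_change \<alpha> S C f
    using C_cont C_pos S f_def f_S by unfold_locales
  define v where "v u = (w (tc.\<phi> u))\<^sup>2" for u
  have v_pos: "0 < v u" if "0 \<le> u" for u
    using w_pos[OF tc.\<phi>_in[OF that]] by (simp add: v_def)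
  have v_cont: "continuous_on {0..} v"
    unfolding v_def
    by (intro continuous_intros continuous_on_compose2[OF w_cont tc.\<phi>_cont]) (use tc.\<phi>_in in auto)
  obtain U where v_mono: "\<And>u u'. U \<le> u \<Longrightarrow> u \<le> u' \<Longrightarrow> v u \<le> v u'"
    using tc.weight_eventually_mono[OF A] unfolding v_def by blast
  have J_iff: "J_integral \<alpha> C c w S < \<infinity> \<longleftrightarrow> summable (\<lambda>j. exp (- c * v (d * real j)))"
    if "0 < d" "0 < c" for c d
    using tc.J_integral_finite_iff[OF that w_cont, of U] v_mono by (simp add: v_def)
  have copy: "process_copy M N {0<..<1} (Y i) X" if "i \<in> {1..n}" for i
    using copies that by (simp add: independent_copies_def)
  have gaussian: "half_line_gaussian M (\<lambda>u. Y i (tc.\<phi> u)) (\<lambda>u u'. r (tc.\<phi> u) (tc.\<phi> u'))"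
    if "i \<in> {1..n}" for i
    by (rule half_line_gaussian_copy[OF prob X_gauss X_centered X_var r_def copy[OF that] tc.\<phi>_in])
  show ?thesis
  proof
    assume "\<exists>c>0. J_integral \<alpha> C c w S < \<infinity>"
    then obtain c where c: "0 < c" "J_integral \<alpha> C c w S < \<infinity>" by blast
    obtain d D \<theta> j1 where d: "0 < d" and D: "0 < D" "0 < \<theta>" "\<theta> < 1" and
      incr: "\<And>j m i. j1 \<le> j \<Longrightarrow> i < 2 ^ m \<Longrightarrow>
        2 * (1 - r (tc.\<phi> (d * real j + d * real (Suc i) / 2 ^ m)) (tc.\<phi> (d * real j + d * real i / 2 ^ m)))
          \<le> (D * \<theta> ^ m)\<^sup>2"
      using tc.condition_B_dyadic[OF B K_rv K_pos alpha(1)] by blast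
    have "AE \<omega> in M. \<exists>L. \<forall>u\<ge>0. (Y i (tc.\<phi> u) \<omega>)\<^sup>2 \<le> L * v u" if i: "i \<in> {1..n}" for i
    proof (rule half_line_gaussian.almost_surely_bounded_by_weight[OF gaussian[OF i] d D])
      have "AE \<omega> in M. continuous_on {0<..<1} (\<lambda>t. Y i t \<omega>)"
        using copy[OF i] by (simp add: process_copy_def as_continuous_paths_def)
      then show "AE \<omega> in M. continuous_on {0..} (\<lambda>u. Y i (tc.\<phi> u) \<omega>)"
      proof eventually_elim
        case (elim \<omega>)
        show ?case by (rule continuous_on_compose2[OF elim tc.\<phi>_cont]) (use tc.\<phi>_in in auto)
      qed
      show "summable (\<lambda>j. exp (- c * v (d * real j)))" using c J_iff[OF d c(1)] by simp
    qed (use incr v_cont v_pos v_mono c in auto)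
    then have "AE \<omega> in M. \<forall>i\<in>{1..n}. \<exists>L. \<forall>u\<ge>0. (Y i (tc.\<phi> u) \<omega>)\<^sup>2 \<le> L * v u"
      by (intro AE_finite_allI) auto
    then show "AE \<omega> in M. (SUP t\<in>half_interval S. ereal (chi_sq n b Y t \<omega> / (w t)\<^sup>2)) < \<infinity>"
    proof eventually_elim
      case (elim \<omega>)
      then obtain L where L: "\<And>i u. i \<in> {1..n} \<Longrightarrow> 0 \<le> u \<Longrightarrow> (Y i (tc.\<phi> u) \<omega>)\<^sup>2 \<le> L i * v u"
        by metis
      have "chi_sq n b Y t \<omega> / (w t)\<^sup>2 \<le> (\<Sum>i=1..n. (b i)\<^sup>2 * L i)" if "t \<in> half_interval S" for t
      proof -
        have t: "t \<in> {0<..<1}" "0 \<le> tc.\<sigma> * f t" using that by (auto simp: tc.half_interval_iff)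
        have "chi_sq n b Y t \<omega> \<le> (\<Sum>i=1..n. (b i)\<^sup>2 * (L i * (w t)\<^sup>2))"
          unfolding chi_sq_def using L[OF _ t(2)]
          by (intro sum_mono mult_left_mono) (auto simp: v_def tc.\<phi>_f[OF t(1)])
        also have "\<dots> = (\<Sum>i=1..n. (b i)\<^sup>2 * L i) * (w t)\<^sup>2" by (simp add: sum_distrib_right mult.assoc)
        finally show ?thesis using w_pos[OF t(1)] by (simp add: field_simps)
      qed
      then have "(SUP t\<in>half_interval S. ereal (chi_sq n b Y t \<omega> / (w t)\<^sup>2)) \<le>
          ereal (\<Sum>i=1..n. (b i)\<^sup>2 * L i)"
        by (intro SUP_least) simp
      then show ?case by (rule order.strict_trans1) simp
    qed
  next
    assume bounded: "AE \<omega> in M. (SUP t\<in>half_interval S. ereal (chi_sq n b Y t \<omega> / (w t)\<^sup>2)) < \<infinity>"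
    have one: "1 \<in> {1..n}" using nk by simp
    obtain d m0 \<beta> :: real and j0 l0 :: nat where d: "0 < d" "0 < m0" "0 < \<beta>" and
      grid: "\<forall>j\<ge>j0. \<forall>l\<ge>l0.
        \<bar>r (tc.\<phi> (d * real (j + l))) (tc.\<phi> (d * real j))\<bar> \<le> m0 * real l powr (- \<beta>)"
      using tc.condition_C_grid[OF C] by (elim exE conjE)
    note corr = grid[rule_format]
    from bounded have dominated: "AE \<omega> in M. \<exists>L. \<forall>u\<ge>0. (Y 1 (tc.\<phi> u) \<omega>)\<^sup>2 \<le> L * v u"
    proof eventually_elim
      case (elim \<omega>)
      then obtain L where L: "(SUP t\<in>half_interval S. ereal (chi_sq n b Y t \<omega> / (w t)\<^sup>2)) < ereal L"
        using ereal_dense2[of _ \<infinity>] by auto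
      have "(Y 1 (tc.\<phi> u) \<omega>)\<^sup>2 \<le> L * v u" if u: "0 \<le> u" for u
      proof -
        have "ereal (chi_sq n b Y (tc.\<phi> u) \<omega> / v u) \<le>
            (SUP t\<in>half_interval S. ereal (chi_sq n b Y t \<omega> / (w t)\<^sup>2))"
          unfolding v_def by (rule SUP_upper[OF tc.\<phi>_half[OF u]])
        then have "chi_sq n b Y (tc.\<phi> u) \<omega> / v u \<le> L"
          using order.strict_trans1[OF _ L] by fastforce
        moreover have "(b 1)\<^sup>2 * (Y 1 (tc.\<phi> u) \<omega>)\<^sup>2 \<le> chi_sq n b Y (tc.\<phi> u) \<omega>"
          unfolding chi_sq_def
          by (rule member_le_sum[OF one, where f = "\<lambda>i. (b i)\<^sup>2 * (Y i (tc.\<phi> u) \<omega>)\<^sup>2"]) auto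
        ultimately show ?thesis
          using b_one[of 1] nk v_pos[OF u] by (simp add: field_simps)
      qed
      then show ?case by blast
    qed
    have "\<exists>c>0. summable (\<lambda>j. exp (- c * v (d * real j)))"
      by (rule half_line_gaussian.weight_summable_if_bounded
          [OF gaussian[OF one] d(1) v_pos v_mono corr d(2,3) dominated])
    then show "\<exists>c>0. J_integral \<alpha> C c w S < \<infinity>" using J_iff[OF d(1)] by blast
  qed
qed

end
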